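(* Let $n,m$ be non-negative integers and consider the two-user symmetric linear deterministic interference channel with parameters $(n,m)$ and channel output feedback model $(F_{11}F_{12}F_{21}F_{22})$. Its capacity region $\mathcal{C}^{(F_{11}F_{12}F_{21}F_{22})}$ is the set of all pairs $(R_1,R_2)$ of non-negative reals satisfying the following inequalities, for each of the 9 canonical feedback models. (i) For the models $(1\mathsf{x}\mathsf{x}1)$, i.e. $(1001)$, $(1101)$, $(1111)$: $$R_1\le \max(n,m),\quad R_2\le\max(n,m),\quad R_1+R_2\le (n-m)^+ +\max(n,m).$$ (ii) For the models $(1100)$, $(1110)$, $(1010)$: $$R_1\le n,\quad R_2\le\max(n,m),\quad R_1+R_2\le (n-m)^+ +\max(n,m).$$ (iii) For the models $(0110)$, $(0010)$: $$R_1\le n,\quad R_2\le n,\quad R_1+R_2\le (n-m)^+ +\max(n,m).$$ (iv) For the model $(1000)$: $$R_1\le n,\quad R_2\le\max(n,m),\quad R_1+R_2\le (n-m)^+ +\max(n,m),\quad 2R_1+R_2\le (n-m)^+ +\max(n,m)+\max(n-m,m).$$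
   Context: Symmetric linear deterministic interference channel with parameters $(n,m)$: let $q=\max(n,m)$ and let $\mathbf{S}$ be the $q\times q$ matrix over $\mathbb{F}_2$ with ones on the first diagonal below the main diagonal and zeros elsewhere. At time $j$, transmitter $\mathsf{T}_u$ ($u\in\{1,2\}$) sends $X_{uj}\in\mathbb{F}_2^q$ (first entry is the most significant bit), and the receivers $\mathsf{D}_1,\mathsf{D}_2$ receive $$Y_{1j}=\mathbf{S}^{q-n}X_{1j}\oplus \mathbf{S}^{q-m}X_{2j},\qquad Y_{2j}=\mathbf{S}^{q-n}X_{2j}\oplus \mathbf{S}^{q-m}X_{1j}.$$ Feedback model: $(F_{11}F_{12}F_{21}F_{22})\in\{0,1\}^4$, where $F_{ku}=1$ iff there is a noiseless, strictly causal feedback link from receiver $\mathsf{D}_k$ to transmitter $\mathsf{T}_u$. Codes: for block length $N$, $W_u$ is uniform on $\{1,\dots,2^{NR_u}\}$, with $W_1,W_2$ independent. The encoder of $\mathsf{T}_u$ is a sequence of functions $X_{uj}=f_{uj}(W_u,\,Y_1^{j-1}F_{1u},\,Y_2^{j-1}F_{2u})$, $j=1,\dots,N$; that is, $X_{uj}$ may depend on $W_u$ and on the past output sequence $Y_k^{j-1}=(Y_{k1},\dots,Y_{k,j-1})$ exactly for those $k$ with $F_{ku}=1$. The decoder of $\mathsf{D}_u$ is a function $\widehat W_u=h_u(Y_u^N)$. A rate pair $(R_1,R_2)$ is achievable if there are codes with $\Pr(\widehat W_u\ne W_u)\to0$ as $N\to\infty$ for both $u=1,2$. The capacity region is the closure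 of the set of achievable rate pairs. Notation: $(x)^+=\max(x,0)$. *)

theory Defs
  imports "HOL-Probability.Probability_Mass_Function" "HOL-Library.Z2" "Jordan_Normal_Form.Matrix"
begin

(* The field F_2 is the type bit; vectors and matrices of variable size are those of
   Jordan_Normal_Form.Matrix, so q = 0 is allowed.  Index 0 is the most significant bit. *)

type_synonym f2vec = "bit Matrix.vec"

definition shift_mat :: "nat \<Rightarrow> bit Matrix.mat" where
  "shift_mat q = Matrix.mat q q (\<lambda>(i, j). if i = Suc j then 1 else 0)"

(* The output at a receiver: x comes from its own transmitter, x' from the other one. *)
definition channel_output :: "nat \<Rightarrow> nat \<Rightarrow> f2vec \<Rightarrow> f2vec \<Rightarrow> f2vec" where
  "channel_output n m x x' =
     (let q = max n m
      in (shift_mat q ^\<^sub>m (q - n)) *\<^sub>v x + (shift_mat q ^\<^sub>m (q - m)) *\<^sub>v x')"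

(* (F11, F12, F21, F22): Fku = 1 iff receiver k feeds its output back to transmitter u. *)
type_synonym feedback_model = "bit \<times> bit \<times> bit \<times> bit"

(* The sequence seen over a feedback link; the empty list stands for an absent link. *)
definition feedback :: "bit \<Rightarrow> f2vec list \<Rightarrow> f2vec list" where
  "feedback b ys = (if b = 1 then ys else [])"

(* Arguments of an encoder: time j (starting from 1), own message, and the
   feedback received from receivers 1 and 2. *)
type_synonym encoder = "nat \<Rightarrow> nat \<Rightarrow> f2vec list \<Rightarrow> f2vec list \<Rightarrow> f2vec"

type_synonym decoder = "f2vec list \<Rightarrow> nat"

definition is_encoder :: "nat \<Rightarrow> encoder \<Rightarrow> bool" where
  "is_encoder q f \<longleftrightarrow> (\<forall>j w ys1 ys2. f j w ys1 ys2 \<in> carrier_vec q)"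

(* The pair of output sequences (Y_1^j, Y_2^j), in chronological order. *)
primrec outputs ::
  "nat \<Rightarrow> nat \<Rightarrow> feedback_model \<Rightarrow> encoder \<Rightarrow> encoder \<Rightarrow> nat \<Rightarrow> nat \<Rightarrow> nat \<Rightarrow> f2vec list \<times> f2vec list"
where
  "outputs n m F f1 f2 w1 w2 0 = ([], [])"
| "outputs n m F f1 f2 w1 w2 (Suc j) =
     (let (F11, F12, F21, F22) = F;
          (ys1, ys2) = outputs n m F f1 f2 w1 w2 j;
          x1 = f1 (Suc j) w1 (feedback F11 ys1) (feedback F21 ys2);
          x2 = f2 (Suc j) w2 (feedback F12 ys1) (feedback F22 ys2)
      in (ys1 @ [channel_output n m x1 x2], ys2 @ [channel_output n m x2 x1]))"

(* {1, ..., 2^(N R)}, read as the positive integers not exceeding the real number 2^(N R). *)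
definition messages :: "nat \<Rightarrow> real \<Rightarrow> nat set" where
  "messages N R = {w. 1 \<le> w \<and> real w \<le> 2 powr (real N * R)}"

definition message_pmf :: "nat \<Rightarrow> real \<Rightarrow> real \<Rightarrow> (nat \<times> nat) pmf" where
  "message_pmf N R1 R2 = pair_pmf (pmf_of_set (messages N R1)) (pmf_of_set (messages N R2))"

definition achievable :: "nat \<Rightarrow> nat \<Rightarrow> feedback_model \<Rightarrow> real \<Rightarrow> real \<Rightarrow> bool" where
  "achievable n m F R1 R2 \<longleftrightarrow> 0 \<le> R1 \<and> 0 \<le> R2 \<and>
     (\<exists>(f1 :: nat \<Rightarrow> encoder) (f2 :: nat \<Rightarrow> encoder) (h1 :: nat \<Rightarrow> decoder) (h2 :: nat \<Rightarrow> decoder).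
        (\<forall>N. is_encoder (max n m) (f1 N) \<and> is_encoder (max n m) (f2 N)) \<and>
        (\<lambda>N. measure_pmf.prob (message_pmf N R1 R2)
           {(w1, w2). h1 N (fst (outputs n m F (f1 N) (f2 N) w1 w2 N)) \<noteq> w1}) \<longlonglongrightarrow> 0 \<and>
        (\<lambda>N. measure_pmf.prob (message_pmf N R1 R2)
           {(w1, w2). h2 N (snd (outputs n m F (f1 N) (f2 N) w1 w2 N)) \<noteq> w2}) \<longlonglongrightarrow> 0)"

definition capacity_region :: "nat \<Rightarrow> nat \<Rightarrow> feedback_model \<Rightarrow> (real \<times> real) set" where
  "capacity_region n m F = closure {(R1, R2). achievable n m F R1 R2}"

definition pos_part :: "real \<Rightarrow> real" where
  "pos_part x = max x 0"

end

theory Submission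
  imports Defs
begin

text \<open>
  Converse: no entropy is needed, everything is counting. On the message pairs decoded correctly, the
  outputs together with the levels that they leave undetermined form an injective image of the
  messages. For the bound on \<open>2 R\<^sub>1 + R\<^sub>2\<close> one counts triples \<open>(a, a', b)\<close> such that both \<open>(a, b)\<close>
  and \<open>(a', b)\<close> are decoded correctly; here \<open>b\<close> alone determines the signal of transmitter 2, as it has
  no feedback.

  Achievability: at each corner point there is a zero-error linear scheme in which a transmitter with
  feedback relays (or cancels in advance) the bits that interfered one time unit earlier. It fits
  \<open>J\<close> blocks of fresh bits into \<open>J + 1\<close> time units, and the missing fresh block at the end starts the
  decoding backwards in time. Concatenation of two corner schemes gives the segments between them.
\<close>

section \<open>Signals\<close>

text \<open>This simp rule rewrites sums in \<open>F\<^sub>2\<close> to exclusive disjunctions, for which the cancellation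
  rules of groups do not fire.\<close>

declare add_bit_eq_xor [simp del]

text \<open>\<open>X a b k i\<close> is the bit actually sent when the messages are \<open>a\<close>
  and \<open>b\<close>, with all feedback already resolved. Feedback then survives only as the
  implication \<open>causal\<close>; \<open>codable_encoders\<close> and
  \<open>achievable_imp_reliable\<close> translate between such signals and encoder functions. The
  models differ for the following reasons. Without a link from receiver 2 to transmitter 2, that
  transmitter can tell receiver 1 nothing about message 1 that receiver 1 has not seen before, so
  user 1 is confined to its direct link of \<open>n\<close> levels. For \<open>m \<le> n\<close>,
  any link into transmitter 1 allows relaying and gives the corner \<open>(n - m, n)\<close>. The
  opposite corner \<open>(n, n - m)\<close> comes from a link into transmitter 2, or from the cross
  link into transmitter 1, which allows cancelling in advance. The model (1000) has neither of
  these, and there the bound on 2 R1 + R2 appears. The counting uses a fixed fraction of good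
  message pairs: this and the rounding of message numbers cost a constant factor, which vanishes in
  the exponent.\<close>

definition sh :: "nat \<Rightarrow> (nat \<Rightarrow> bit) \<Rightarrow> nat \<Rightarrow> bit" where
  "sh k x i = (if k \<le> i then x (i - k) else 0)"

definition chan :: "nat \<Rightarrow> nat \<Rightarrow> (nat \<Rightarrow> bit) \<Rightarrow> (nat \<Rightarrow> bit) \<Rightarrow> nat \<Rightarrow> bit" where
  "chan n m x x' i = sh (max n m - n) x i + sh (max n m - m) x' i"

lemma shift_mat_carrier [simp]: "shift_mat q \<in> carrier_mat q q"
  by (simp add: shift_mat_def)

lemma shift_mat_pow_carrier [simp]: "shift_mat q ^\<^sub>m k \<in> carrier_mat q q"
  by (induction k) (auto simp: shift_mat_def)

lemma shift_mat_mult_vec: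
  "shift_mat q *\<^sub>v vec q x = vec q (sh 1 x)"
proof (intro eq_vecI)
  fix i assume "i < dim_vec (vec q (sh 1 x))"
  hence i: "i < q" by simp
  have "(shift_mat q *\<^sub>v vec q x) $ i = (\<Sum>j<q. (if i = Suc j then 1 else 0) * x j)"
    using i by (simp add: shift_mat_def scalar_prod_def lessThan_atLeast0)
  also have "\<dots> = (\<Sum>j<q. if i = Suc j then x j else 0)"
    by (intro sum.cong) auto
  also have "\<dots> = sh 1 x i"
    using i by (cases i) (auto simp: sh_def)
  finally show "(shift_mat q *\<^sub>v vec q x) $ i = vec q (sh 1 x) $ i"
    using i by simp
qed (simp add: shift_mat_def)

lemma shift_mat_pow_mult_vec:
  "(shift_mat q ^\<^sub>m k) *\<^sub>v vec q x = vec q (sh k x)"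
proof (induction k arbitrary: x)
  case 0
  then show ?case by (intro eq_vecI) (auto simp: sh_def shift_mat_def)
next
  case (Suc k)
  have "(shift_mat q ^\<^sub>m Suc k) *\<^sub>v vec q x = (shift_mat q ^\<^sub>m k) *\<^sub>v (shift_mat q *\<^sub>v vec q x)"
    by (simp add: assoc_mult_mat_vec[where ?n\<^sub>1 = q and ?n\<^sub>2 = q and ?n\<^sub>3 = q])
  also have "\<dots> = vec q (sh k (sh 1 x))"
    by (simp only: shift_mat_mult_vec Suc)
  also have "sh k (sh 1 x) = sh (Suc k) x"
    by (auto simp: sh_def fun_eq_iff)
  finally show ?case .
qed

text \<open>Matrices are left behind here: from now on the channel is \<open>chan\<close>, acting on
  bit functions of which only the first \<open>max n m\<close> values count.\<close>

lemma channel_output_vec: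
  "channel_output n m (vec (max n m) x) (vec (max n m) x') = vec (max n m) (chan n m x x')"
  by (intro eq_vecI) (auto simp: channel_output_def Let_def shift_mat_pow_mult_vec chan_def)

text \<open>Weak interference: the top \<open>m\<close> levels of the other signal hit the lowest
  \<open>m\<close> levels of the receiver, its lowest \<open>n - m\<close> levels are lost on the
  cross link, and the top \<open>n - m\<close> levels of the receiver stay clean. The schemes for
  \<open>m \<le> n\<close> are built on these three facts.\<close>

lemma chan_weak:
  assumes "m \<le> n"
  shows "chan n m x x' i = x i + (if n - m \<le> i then x' (i - (n - m)) else 0)"
  using assms by (auto simp: chan_def sh_def max_def)

text \<open>Strong interference: of the own signal only the top \<open>n\<close> levels arrive, in
  the lowest \<open>n\<close> levels of the receiver, while the cross link delivers
  everything.\<close>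

lemma chan_strong:
  assumes "n \<le> m"
  shows "chan n m x x' i = (if m - n \<le> i then x (i - (m - n)) else 0) + x' i"
  using assms by (auto simp: chan_def sh_def max_def)

definition same :: "nat \<Rightarrow> nat \<Rightarrow> (nat \<Rightarrow> nat \<Rightarrow> bit) \<Rightarrow> (nat \<Rightarrow> nat \<Rightarrow> bit) \<Rightarrow> bool" where
  "same q N y y' \<longleftrightarrow> (\<forall>k<N. \<forall>i<q. y k i = y' k i)"

type_synonym ('a, 'b) signal = "'a \<Rightarrow> 'b \<Rightarrow> nat \<Rightarrow> nat \<Rightarrow> bit"

definition rx :: "nat \<Rightarrow> nat \<Rightarrow> ('a, 'b) signal \<Rightarrow> ('b, 'a) signal \<Rightarrow> ('a, 'b) signal" where
  "rx n m X X' a b k = chan n m (X a b k) (X' b a k)"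

text \<open>\<open>Fo\<close> and \<open>Fc\<close> are the feedback links from the transmitter's own and from the other receiver.
  Time starts at 0 here. Every signal takes the own message first, so that statements about user 2
  are those about user 1 with the roles swapped.\<close>

definition causal ::
  "nat \<Rightarrow> nat \<Rightarrow> bit \<Rightarrow> bit \<Rightarrow> nat \<Rightarrow> 'a set \<Rightarrow> 'b set \<Rightarrow> ('a, 'b) signal \<Rightarrow> ('b, 'a) signal \<Rightarrow> bool"
where
  "causal n m Fo Fc N A B X X' \<longleftrightarrow>
     (\<forall>a\<in>A. \<forall>b\<in>B. \<forall>b'\<in>B. \<forall>k<N.
        (Fo = 1 \<longrightarrow> same (max n m) k (rx n m X X' a b) (rx n m X X' a b')) \<longrightarrow>
        (Fc = 1 \<longrightarrow> same (max n m) k (rx n m X' X b a) (rx n m X' X b' a)) \<longrightarrow>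
        (\<forall>i<max n m. X a b k i = X a b' k i))"

text \<open>Relative to a set \<open>G\<close> of pairs, so that one notion serves the schemes,
  where \<open>G\<close> is a full product, and the converse, where \<open>G\<close> holds the
  correctly decoded pairs.\<close>

definition decodable ::
  "nat \<Rightarrow> nat \<Rightarrow> nat \<Rightarrow> ('a \<times> 'b) set \<Rightarrow> ('a, 'b) signal \<Rightarrow> ('b, 'a) signal \<Rightarrow> bool"
where
  "decodable n m N G X X' \<longleftrightarrow>
     (\<forall>(a, b)\<in>G. \<forall>(a', b')\<in>G.
        same (max n m) N (rx n m X X' a b) (rx n m X X' a' b') \<longrightarrow> a = a')"

definition zero_error ::
  "nat \<Rightarrow> nat \<Rightarrow> feedback_model \<Rightarrow> nat \<Rightarrow> 'a set \<Rightarrow> 'b set \<Rightarrow> ('a, 'b) signal \<Rightarrow> ('b, 'a) signal \<Rightarrow> bool"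
where
  "zero_error n m F N A B X X' \<longleftrightarrow>
     (case F of (F11, F12, F21, F22) \<Rightarrow>
        causal n m F11 F21 N A B X X' \<and> causal n m F22 F12 N B A X' X \<and>
        decodable n m N (A \<times> B) X X' \<and> decodable n m N (B \<times> A) X' X)"

text \<open>The messages of a scheme. Zeros outside the rectangle make equality of functions the
  same as equality of messages, and let a scheme read block \<open>J\<close> in its last time
  unit.\<close>

definition streams :: "nat \<Rightarrow> nat \<Rightarrow> (nat \<Rightarrow> nat \<Rightarrow> bit) set" where
  "streams J r = {a. \<forall>k i. a k i \<noteq> 0 \<longrightarrow> k < J \<and> i < r}"

lemma streams_zero:
  assumes "a \<in> streams J r" "J \<le> k \<or> r \<le> i"
  shows "a k i = 0"
proof (rule ccontr)
  assume "a k i \<noteq> 0"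
  then have "k < J \<and> i < r" using assms(1) unfolding streams_def by simp
  then show False using assms(2) by linarith
qed

lemma streams_eqI:
  assumes "a \<in> streams J r" "a' \<in> streams J r" "\<And>k i. k < J \<Longrightarrow> i < r \<Longrightarrow> a k i = a' k i"
  shows "a = a'"
proof (intro ext)
  fix k i show "a k i = a' k i"
  proof (cases "k < J \<and> i < r")
    case False
    then have "J \<le> k \<or> r \<le> i" by linarith
    then show ?thesis using assms(1,2)[THEN streams_zero] by simp
  next
    case True
    then show ?thesis using assms(3) by blast
  qed
qed

lemma streams_bij:
  "bij_betw (\<lambda>a. {(k, i). a k i = (1::bit)}) (streams J r) (Pow ({..<J} \<times> {..<r}))"
proof (rule bij_betw_byWitness[where f' = "\<lambda>S k i. of_bool ((k, i) \<in> S)"])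
  show "\<forall>a\<in>streams J r. (\<lambda>k i. of_bool ((k, i) \<in> {(k, i). a k i = 1})) = a"
  proof (intro ballI ext)
    fix a :: "nat \<Rightarrow> nat \<Rightarrow> bit" and k i
    show "of_bool ((k, i) \<in> {(k, i). a k i = 1}) = a k i"
      by (cases "a k i") simp_all
  qed
  show "\<forall>S\<in>Pow ({..<J} \<times> {..<r}). {(k, i). (of_bool ((k, i) \<in> S) :: bit) = 1} = S"
    by simp
  show "(\<lambda>a. {(k, i). a k i = 1}) ` streams J r \<subseteq> Pow ({..<J} \<times> {..<r})"
    unfolding streams_def by fastforce
  show "(\<lambda>S k i. of_bool ((k, i) \<in> S)) ` Pow ({..<J} \<times> {..<r}) \<subseteq> streams J r"
    unfolding streams_def by auto
qed

lemma finite_streams [simp]: "finite (streams J r)"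
  using bij_betw_finite[OF streams_bij] by simp

lemma card_streams [simp]: "card (streams J r) = 2 ^ (J * r)"
  using bij_betw_same_card[OF streams_bij, of J r] by (simp add: card_Pow card_cartesian_product)

definition delay :: "(nat \<Rightarrow> nat \<Rightarrow> bit) \<Rightarrow> nat \<Rightarrow> nat \<Rightarrow> bit" where
  "delay b k i = (case k of 0 \<Rightarrow> 0 | Suc k' \<Rightarrow> b k' i)"

lemma delay_simps [simp]: "delay b 0 i = 0" "delay b (Suc k) i = b k i"
  by (auto simp: delay_def)

lemma delay_cong:
  assumes "\<And>k'. k' < k \<Longrightarrow> b k' i = b' k' i"
  shows "delay b k i = delay b' k i"
  using assms by (cases k) auto

text \<open>Backward decoding of a delayed stream: it starts since block \<open>J\<close> carries no fresh bits.\<close>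

lemma streams_backward:
  assumes "b \<in> streams J r" "b' \<in> streams J r"
    and "\<And>k i. k < J \<Longrightarrow> i < s \<Longrightarrow> (\<And>i. i < s \<Longrightarrow> b (Suc k) i = b' (Suc k) i) \<Longrightarrow> b k i = b' k i"
    and "i < s"
  shows "b k i = b' k i"
proof (cases "k < J")
  case True
  then have "k \<le> J" by simp
  then show ?thesis using assms(4)
  proof (induction k arbitrary: i rule: inc_induct)
    case base
    then show ?case using assms(1,2) by (simp add: streams_zero)
  next
    case (step k)
    show ?case
      by (rule assms(3)[OF \<open>k < J\<close> \<open>i < s\<close> step.IH])
  qed
next
  case False
  then show ?thesis using assms(1,2) by (simp add: streams_zero)
qed

section \<open>Zero-error codes at the corner points\<close>

text \<open>Tailored to the schemes below, in which transmitter 2 ignores feedback (second premise).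
  They therefore work for arbitrary links into transmitter 2.\<close>

lemma zero_errorI:
  assumes "\<And>a b b' k. a \<in> A \<Longrightarrow> b \<in> B \<Longrightarrow> b' \<in> B \<Longrightarrow>
      (F11 = 1 \<Longrightarrow> \<forall>k'<k. \<forall>i<max n m. rx n m X X' a b k' i = rx n m X X' a b' k' i) \<Longrightarrow>
      (F21 = 1 \<Longrightarrow> \<forall>k'<k. \<forall>i<max n m. rx n m X' X b a k' i = rx n m X' X b' a k' i) \<Longrightarrow>
      \<forall>i<max n m. X a b k i = X a b' k i"
    and "\<And>a a' b k i. X' b a k i = X' b a' k i"
    and "\<And>a a' b b'. a \<in> A \<Longrightarrow> a' \<in> A \<Longrightarrow> b \<in> B \<Longrightarrow> b' \<in> B \<Longrightarrow>
      \<forall>k<N. \<forall>i<max n m. rx n m X X' a b k i = rx n m X X' a' b' k i \<Longrightarrow> a = a'"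
    and "\<And>a a' b b'. a \<in> A \<Longrightarrow> a' \<in> A \<Longrightarrow> b \<in> B \<Longrightarrow> b' \<in> B \<Longrightarrow>
      \<forall>k<N. \<forall>i<max n m. rx n m X' X b a k i = rx n m X' X b' a' k i \<Longrightarrow> b = b'"
  shows "zero_error n m (F11, F12, F21, F22) N A B X X'"
proof -
  have "causal n m F11 F21 N A B X X'"
    unfolding causal_def same_def using assms(1) by blast
  moreover have "causal n m F22 F12 N B A X' X"
    unfolding causal_def using assms(2) by blast
  moreover have "decodable n m N (A \<times> B) X X'"
    unfolding decodable_def same_def using assms(3) by blast
  moreover have "decodable n m N (B \<times> A) X' X"
    unfolding decodable_def same_def using assms(4) by blast
  ultimately show ?thesis by (simp add: zero_error_def)
qed

text \<open>Renaming the users renames receivers and transmitters at once, which reverses the order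
  of the four links.\<close>

lemma zero_error_swap:
  assumes "zero_error n m (F22, F21, F12, F11) N B A X' X"
  shows "zero_error n m (F11, F12, F21, F22) N A B X X'"
  using assms by (simp add: zero_error_def)

definition codable :: "nat \<Rightarrow> nat \<Rightarrow> feedback_model \<Rightarrow> nat \<Rightarrow> nat \<Rightarrow> nat \<Rightarrow> bool" where
  "codable n m F N M1 M2 \<longleftrightarrow> (\<exists>X X'. zero_error n m F N {1..M1} {1..M2} X X')"

lemma codable_swap:
  assumes "codable n m (F22, F21, F12, F11) N M2 M1"
  shows "codable n m (F11, F12, F21, F22) N M1 M2"
  using assms zero_error_swap unfolding codable_def by blast

text \<open>Relabelling: inject the numbered messages into \<open>A\<close> and \<open>B\<close>.
  Causality and decodability are universal statements about messages, so they survive the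
  restriction.\<close>

lemma codableI:
  assumes "zero_error n m F N A B X X'" "finite A" "finite B" "M1 \<le> card A" "M2 \<le> card B"
  shows "codable n m F N M1 M2"
proof -
  obtain g where g: "g ` {1..M1} \<subseteq> A" "inj_on g {1..M1}"
    using card_le_inj[of "{1..M1}" A] assms by auto
  obtain h where h: "h ` {1..M2} \<subseteq> B" "inj_on h {1..M2}"
    using card_le_inj[of "{1..M2}" B] assms by auto
  obtain F11 F12 F21 F22 where F: "F = (F11, F12, F21, F22)" by (metis prod_cases4)
  let ?X = "\<lambda>a b. X (g a) (h b)" and ?X' = "\<lambda>b a. X' (h b) (g a)"
  have rx: "rx n m ?X ?X' a b = rx n m X X' (g a) (h b)" "rx n m ?X' ?X b a = rx n m X' X (h b) (g a)"
    for a b by (auto simp: rx_def fun_eq_iff)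
  have "causal n m F11 F21 N A B X X'" "causal n m F22 F12 N B A X' X"
    "decodable n m N (A \<times> B) X X'" "decodable n m N (B \<times> A) X' X"
    using assms(1) by (auto simp: zero_error_def F)
  note Z = this
  have "causal n m F11 F21 N {1..M1} {1..M2} ?X ?X'"
    using Z(1) g(1) h(1) unfolding causal_def rx by blast
  moreover have "causal n m F22 F12 N {1..M2} {1..M1} ?X' ?X"
    using Z(2) g(1) h(1) unfolding causal_def rx by blast
  moreover have "decodable n m N ({1..M1} \<times> {1..M2}) ?X ?X'"
    unfolding decodable_def rx
  proof clarsimp
    fix a b a' b' :: nat
    assume "Suc 0 \<le> a" "a \<le> M1" "Suc 0 \<le> b" "b \<le> M2" "Suc 0 \<le> a'" "a' \<le> M1" "Suc 0 \<le> b'" "b' \<le> M2"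
      and s: "same (max n m) N (rx n m X X' (g a) (h b)) (rx n m X X' (g a') (h b'))"
    then have *: "a \<in> {1..M1}" "a' \<in> {1..M1}" "b \<in> {1..M2}" "b' \<in> {1..M2}" by auto
    then have "g a = g a'" using Z(3) s g(1) h(1) unfolding decodable_def by blast
    with * show "a = a'" using g(2) by (meson inj_onD)
  qed
  moreover have "decodable n m N ({1..M2} \<times> {1..M1}) ?X' ?X"
    unfolding decodable_def rx
  proof clarsimp
    fix b a b' a' :: nat
    assume "Suc 0 \<le> b" "b \<le> M2" "Suc 0 \<le> a" "a \<le> M1" "Suc 0 \<le> b'" "b' \<le> M2" "Suc 0 \<le> a'" "a' \<le> M1"
      and s: "same (max n m) N (rx n m X' X (h b) (g a)) (rx n m X' X (h b') (g a'))"
    then have *: "a \<in> {1..M1}" "a' \<in> {1..M1}" "b \<in> {1..M2}" "b' \<in> {1..M2}" by auto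
    then have "h b = h b'" using Z(4) s g(1) h(1) unfolding decodable_def by blast
    with * show "b = b'" using h(2) by (meson inj_onD)
  qed
  ultimately have "zero_error n m F N {1..M1} {1..M2} ?X ?X'"
    by (simp add: zero_error_def F)
  then show ?thesis unfolding codable_def by blast
qed

text \<open>The extra time unit lowers the rates only by the factor J/(J+1), which tends to 1. The
  case \<open>J = 0\<close> is included because a share in time sharing may be empty.\<close>

definition corner :: "nat \<Rightarrow> nat \<Rightarrow> feedback_model \<Rightarrow> nat \<Rightarrow> nat \<Rightarrow> bool" where
  "corner n m F r1 r2 \<longleftrightarrow> (\<forall>J. codable n m F (Suc J) (2 ^ (J * r1)) (2 ^ (J * r2)))"

lemma corner_swap:
  "corner n m (F22, F21, F12, F11) r2 r1 \<Longrightarrow> corner n m (F11, F12, F21, F22) r1 r2"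
  by (simp add: corner_def codable_swap)

lemma cornerI:
  assumes "\<And>J. zero_error n m F (Suc J) (streams J r1) (streams J r2) X X'"
  shows "corner n m F r1 r2"
  unfolding corner_def using codableI[OF assms] by simp

text \<open>Transmitter 1 relays the previous interfering bits of transmitter 2 in its own top levels.
  Receiver 2 resolves them forwards, receiver 1 backwards in time.\<close>

lemma corner_relay:
  assumes "m \<le> n" "F11 = 1 \<or> F21 = 1"
  shows "corner n m (F11, F12, F21, F22) (n - m) n"
proof (intro cornerI)
  fix J
  define d where "d = n - m"
  define X :: "(nat \<Rightarrow> nat \<Rightarrow> bit, nat \<Rightarrow> nat \<Rightarrow> bit) signal"
    where "X a b k i = (if i < m then delay b k i else a k (i - m))" for a b k i
  define X' :: "(nat \<Rightarrow> nat \<Rightarrow> bit, nat \<Rightarrow> nat \<Rightarrow> bit) signal" where "X' b a = b" for b a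
  have q: "max n m = n" "m + d = n" using assms by (auto simp: d_def)
  have Y: "rx n m X X' a b k i = X a b k i + (if d \<le> i then b k (i - d) else 0)" for a b k i
    using assms(1) by (simp add: rx_def chan_weak d_def X'_def)
  have Y': "rx n m X' X b a k i = b k i + (if d \<le> i then X a b k (i - d) else 0)" for a b k i
    using assms(1) by (simp add: rx_def chan_weak d_def X'_def)
  have Xcong: "X a b k i = X a b' k i"
    if "\<And>k' i. k' < k \<Longrightarrow> i < m \<Longrightarrow> b k' i = b' k' i" for a b b' k i
    using that delay_cong[of k b i b'] by (simp add: X_def)
  show "zero_error n m (F11, F12, F21, F22) (Suc J) (streams J (n - m)) (streams J n) X X'"
  proof (rule zero_errorI, unfold q)
    fix a b b' k
    assume y: "F11 = 1 \<Longrightarrow> \<forall>k'<k. \<forall>i<n. rx n m X X' a b k' i = rx n m X X' a b' k' i"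
      and y': "F21 = 1 \<Longrightarrow> \<forall>k'<k. \<forall>i<n. rx n m X' X b a k' i = rx n m X' X b' a k' i"
    \<comment> \<open>Transmitter 1 can reproduce its own past signal from earlier bits of
      \<open>b\<close>; subtracting it from either fed back output exposes the next bits of
      \<open>b\<close>.\<close>
    have "b k' i = b' k' i" if "k' < k" "i < m" for k' i
      using that
    proof (induction k' arbitrary: i rule: less_induct)
      case (less k')
      have X: "X a b k' i = X a b' k' i" for i
        by (rule Xcong) (use less in auto)
      from assms(2) show ?case
      proof
        assume "F11 = 1"
        with y have "rx n m X X' a b k' (i + d) = rx n m X X' a b' k' (i + d)"
          using less q by auto
        then show ?thesis by (simp add: Y X)
      next
        assume "F21 = 1"
        with y' have "rx n m X' X b a k' i = rx n m X' X b' a k' i"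
          using less q by auto
        then show ?thesis by (simp add: Y' X split: if_splits)
      qed
    qed
    then show "\<forall>i<n. X a b k i = X a b' k i"
      using Xcong by blast
  next
    fix a a' b b'
    assume s: "a \<in> streams J (n - m)" "a' \<in> streams J (n - m)" "b \<in> streams J n" "b' \<in> streams J n"
      and "\<forall>k<Suc J. \<forall>i<n. rx n m X X' a b k i = rx n m X X' a' b' k i"
    then have y: "rx n m X X' a b k i = rx n m X X' a' b' k i" if "k \<le> J" "i < n" for k i
      using that by auto
    \<comment> \<open>In time unit \<open>k + 1\<close>, level \<open>i\<close> of receiver 1
      carries the relayed \<open>b k i\<close>, plus at most one bit of block \<open>k + 1\<close>,
      known already when decoding backwards.\<close>
    have b: "b k i = b' k i" if "i < m" for k i
      using s(3,4) _ that
    proof (rule streams_backward)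
      fix k i assume *: "k < J" "i < m" "\<And>i. i < m \<Longrightarrow> b (Suc k) i = b' (Suc k) i"
      then show "b k i = b' k i"
        using y[of "Suc k" i] q by (auto simp: Y X_def split: if_splits)
    qed
    show "a = a'" using s(1,2)
    proof (rule streams_eqI)
      fix k i assume "k < J" "i < n - m"
      then show "a k i = a' k i" using y[of k "m + i"] b[of "m + i - d" k] q
        by (auto simp: Y X_def split: if_splits)
    qed
  next
    fix a a' b b'
    assume s: "b \<in> streams J n" "b' \<in> streams J n"
      and y: "\<forall>k<Suc J. \<forall>i<n. rx n m X' X b a k i = rx n m X' X b' a' k i"
    \<comment> \<open>Only the relaying levels of transmitter 1 reach receiver 2, and they carry its
      own past bits.\<close>
    have "b k i = b' k i" if "k < J" "i < n" for k i
      using that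
    proof (induction k arbitrary: i rule: less_induct)
      case (less k)
      have "delay b k i = delay b' k i" if "i < n" for i
        by (rule delay_cong) (use less that in auto)
      then have "d \<le> i \<Longrightarrow> X a b k (i - d) = X a' b' k (i - d)"
        using less(3) q by (auto simp: X_def)
      then show ?case using y[rule_format, of k i] less(2,3) by (simp add: Y' split: if_splits)
    qed
    then show "b = b'" by (rule streams_eqI[OF s])
  qed (simp add: X'_def)
qed

text \<open>Transmitter 2 first sends its bits in its own low levels, where only receiver 2 (and, through
  the feedback, transmitter 1) sees them. When it repeats them in the top levels, transmitter 1
  cancels the interference in advance.\<close>

lemma corner_precancel:
  assumes "m \<le> n"
  shows "corner n m (F11, F12, 1, F22) n (n - m)"
proof (intro cornerI)
  fix J
  define d where "d = n - m"
  define X :: "(nat \<Rightarrow> nat \<Rightarrow> bit, nat \<Rightarrow> nat \<Rightarrow> bit) signal"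
    where "X a b k i = a k i + (if d \<le> i \<and> i - d < d then delay b k (i - d) else 0)" for a b k i
  define X' :: "(nat \<Rightarrow> nat \<Rightarrow> bit, nat \<Rightarrow> nat \<Rightarrow> bit) signal"
    where "X' b a k i = (if m \<le> i then b k (i - m) else 0) + (if i < d then delay b k i else 0)" for b a k i
  have q: "max n m = n" "m + d = n" using assms by (auto simp: d_def)
  \<comment> \<open>Of \<open>X'\<close> only levels below \<open>m\<close> reach receiver 1. There
    it consists of repeated bits, which the second summand of \<open>X\<close> cancels.\<close>
  have Y: "rx n m X X' a b k i = a k i" if "i < n" for a b k i
    using assms(1) that by (auto simp: rx_def chan_weak d_def X_def X'_def)
  have Y': "rx n m X' X b a k i = X' b a k i + (if d \<le> i then X a b k (i - d) else 0)" for a b k i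
    using assms(1) by (simp add: rx_def chan_weak d_def)
  have Xcong: "X a b k i = X a b' k i"
    if "\<And>k' i. k' < k \<Longrightarrow> i < d \<Longrightarrow> b k' i = b' k' i" for a b b' k i
    using that delay_cong[of k b "i - d" b'] by (simp add: X_def)
  show "zero_error n m (F11, F12, 1, F22) (Suc J) (streams J n) (streams J (n - m)) X X'"
  proof (rule zero_errorI, unfold q)
    fix a b b' k
    assume "1 = (1 :: bit) \<Longrightarrow> \<forall>k'<k. \<forall>i<n. rx n m X' X b a k' i = rx n m X' X b' a k' i"
    then have y: "rx n m X' X b a k' i = rx n m X' X b' a k' i" if "k' < k" "i < n" for k' i
      using that by simp
    \<comment> \<open>Level \<open>m + i\<close> of receiver 2 carries the fresh
      \<open>b k' i\<close>; everything else on it is own signal of transmitter 1 or an earlier bit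
      of \<open>b\<close>.\<close>
    have "b k' i = b' k' i" if "k' < k" "i < d" for k' i
      using that
    proof (induction k' arbitrary: i rule: less_induct)
      case (less k')
      have X: "X a b k' i = X a b' k' i" for i
        by (rule Xcong) (use less in auto)
      have "delay b k' i = delay b' k' i" if "i < d" for i
        by (rule delay_cong) (use less that in auto)
      then have "X' b a k' (m + i) - b k' i = X' b' a k' (m + i) - b' k' i"
        by (simp add: X'_def)
      moreover have "X' b a k' (m + i) = X' b' a k' (m + i)"
        using y[of k' "m + i"] less(2,3) q by (simp add: Y' X split: if_splits)
      ultimately show ?case by simp
    qed
    then show "\<forall>i<n. X a b k i = X a b' k i"
      using Xcong by blast
  next
    fix a a' b b'
    assume s: "a \<in> streams J n" "a' \<in> streams J n"
      and "\<forall>k<Suc J. \<forall>i<n. rx n m X X' a b k i = rx n m X X' a' b' k i"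
    then show "a = a'" by (intro streams_eqI[OF s]) (simp add: Y)
  next
    fix a a' b b'
    assume s: "b \<in> streams J (n - m)" "b' \<in> streams J (n - m)"
      and "\<forall>k<Suc J. \<forall>i<n. rx n m X' X b a k i = rx n m X' X b' a' k i"
    then have y: "rx n m X' X b a k i = rx n m X' X b' a' k i" if "k \<le> J" "i < n" for k i
      using that by auto
    \<comment> \<open>Receiver 2 decodes from the repetition: its top \<open>d\<close> levels are
      free of interference and in time unit \<open>k + 1\<close> show \<open>b k i\<close>, plus a
      bit of block \<open>k + 1\<close> if \<open>m \<le> i\<close>.\<close>
    have "b k i = b' k i" if "i < d" for k i
      using s _ that
    proof (rule streams_backward)
      fix k i assume *: "k < J" "i < d" "\<And>i. i < d \<Longrightarrow> b (Suc k) i = b' (Suc k) i"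
      then show "b k i = b' k i"
        using y[of "Suc k" i] *(3)[of "i - m"] q by (auto simp: Y' X'_def split: if_splits)
    qed
    then show "b = b'" using streams_eqI[OF s] by (simp add: d_def)
  qed (simp add: X'_def)
qed

text \<open>Transmitter 1 repeats the previous interfering bits in the only levels that hit the low levels of
  receiver 2, which knows these bits already; receiver 1 resolves them backwards in time.\<close>

lemma corner_resolve:
  assumes "m \<le> n" "n \<le> 2 * m"
  shows "corner n m (1, F12, F21, F22) m (2 * (n - m))"
proof (intro cornerI)
  fix J
  define d where "d = n - m"
  define e where "e = m - d"
  \<comment> \<open>At receiver 2, levels \<open>0..<e\<close> of \<open>X\<close> land in the gap
    \<open>d..<m\<close> that \<open>X'\<close> leaves empty, and the relaying levels
    \<open>e..<m\<close> land on the low bits \<open>m..<n\<close>. The levels of \<open>X\<close>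
    from \<open>m\<close> on are invisible there.\<close>
  define X :: "(nat \<Rightarrow> nat \<Rightarrow> bit, nat \<Rightarrow> nat \<Rightarrow> bit) signal"
    where "X a b k i = (if i < e then a k i
                          else if i < m then delay b k (i - e) else a k (i - d))" for a b k i
  define X' :: "(nat \<Rightarrow> nat \<Rightarrow> bit, nat \<Rightarrow> nat \<Rightarrow> bit) signal"
    where "X' b a k i = (if i < d then b k i else if m \<le> i then b k (d + (i - m)) else 0)" for b a k i
  have q: "max n m = n" "m + d = n" "d + e = m" using assms by (auto simp: d_def e_def)
  have Y: "rx n m X X' a b k i = X a b k i + (if d \<le> i \<and> i - d < d then b k (i - d) else 0)"
    if "i < n" for a b k i
    using assms(1) that by (auto simp: rx_def chan_weak d_def X'_def)
  have Y': "rx n m X' X b a k i = X' b a k i + (if d \<le> i then X a b k (i - d) else 0)" for a b k i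
    using assms(1) by (simp add: rx_def chan_weak d_def)
  have Xcong: "X a b k i = X a b' k i"
    if "\<And>k' i. k' < k \<Longrightarrow> i < d \<Longrightarrow> b k' i = b' k' i" for a b b' k i
  proof -
    have "delay b k i = delay b' k i" if "i < d" for i
      by (rule delay_cong) (use that \<open>\<And>k' i. k' < k \<Longrightarrow> i < d \<Longrightarrow> b k' i = b' k' i\<close> in auto)
    then show ?thesis using q by (auto simp: X_def)
  qed
  show "zero_error n m (1, F12, F21, F22) (Suc J) (streams J m) (streams J (2 * (n - m))) X X'"
  proof (rule zero_errorI, unfold q)
    fix a b b' k
    assume "1 = (1 :: bit) \<Longrightarrow> \<forall>k'<k. \<forall>i<n. rx n m X X' a b k' i = rx n m X X' a b' k' i"
    then have y: "rx n m X X' a b k' i = rx n m X X' a b' k' i" if "k' < k" "i < n" for k' i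
      using that by simp
    have "b k' i = b' k' i" if "k' < k" "i < d" for k' i
      using that
    proof (induction k' arbitrary: i rule: less_induct)
      case (less k')
      have X: "X a b k' i = X a b' k' i" for i
        by (rule Xcong) (use less in auto)
      show ?case
        using y[of k' "i + d"] less(2,3) q by (simp add: Y X)
    qed
    then show "\<forall>i<n. X a b k i = X a b' k i"
      using Xcong by blast
  next
    fix a a' b b'
    assume s: "a \<in> streams J m" "a' \<in> streams J m"
        "b \<in> streams J (2 * (n - m))" "b' \<in> streams J (2 * (n - m))"
      and "\<forall>k<Suc J. \<forall>i<n. rx n m X X' a b k i = rx n m X X' a' b' k i"
    then have y: "rx n m X X' a b k i = rx n m X X' a' b' k i" if "k \<le> J" "i < n" for k i
      using that by auto
    \<comment> \<open>Level \<open>i + e\<close> of receiver 1 carries the relayed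
      \<open>b k i\<close> in time unit \<open>k + 1\<close>, possibly plus a top bit of block
      \<open>k + 1\<close>.\<close>
    have b: "b k i = b' k i" if "i < d" for k i
      using s(3,4) _ that
    proof (rule streams_backward)
      fix k i assume *: "k < J" "i < d" "\<And>i. i < d \<Longrightarrow> b (Suc k) i = b' (Suc k) i"
      let ?i = "i + e"
      have i: "?i < n" using *(2) q by simp
      have "X a b (Suc k) ?i = X a' b' (Suc k) ?i"
        using y[of "Suc k" ?i, unfolded Y[OF i]] *(1) *(3)[of "?i - d"] i
        by (cases "d \<le> ?i \<and> ?i - d < d") auto
      then show "b k i = b' k i" using *(2) q by (simp add: X_def)
    qed
    have X: "X a b k i = X a' b' k i" if "k \<le> J" "i < n" for k i
      using y[OF that] that b[of "i - d" k] by (auto simp: Y split: if_splits)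
    show "a = a'" using s(1,2)
    proof (rule streams_eqI)
      fix k i assume *: "k < J" "i < m"
      show "a k i = a' k i"
      proof (cases "i < e")
        case True
        then show ?thesis using X[of k i] * q by (simp add: X_def)
      next
        case False
        then show ?thesis using X[of k "i + d"] * q by (simp add: X_def)
      qed
    qed
  next
    fix a a' b b'
    assume s: "b \<in> streams J (2 * (n - m))" "b' \<in> streams J (2 * (n - m))"
      and y: "\<forall>k<Suc J. \<forall>i<n. rx n m X' X b a k i = rx n m X' X b' a' k i"
    have top: "b k i = b' k i" if "i < d" "k < J" for k i
      using y[rule_format, of k i] that q by (simp add: Y' X'_def)
    show "b = b'" using s
    proof (rule streams_eqI)
      fix k i assume *: "k < J" "i < 2 * (n - m)"
      show "b k i = b' k i"
      proof (cases "i < d")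
        case False
        then have "i - d < d" "d \<le> i" using * by (simp_all add: d_def)
        then obtain t where t: "i = d + t" "t < d" by (metis le_add_diff_inverse)
        \<comment> \<open>The low bit \<open>d + t\<close> is disturbed only by the relayed top bit
          \<open>t\<close> of the previous block, which arrived cleanly at receiver 2.\<close>
        have "delay b k t = delay b' k t"
          by (rule delay_cong) (use top * t in auto)
        moreover have "X a b k (e + t) = delay b k t" for a b
          using q t(2) by (simp add: X_def)
        moreover have "X' b a k (m + t) = b k i" for a b
          using q t by (simp add: X'_def)
        moreover have "m + t - d = e + t" "d \<le> m + t" using q by simp_all
        ultimately show ?thesis
          using y[rule_format, of k "m + t"] * q t(2) by (simp add: Y')
      qed (use top * in auto)
    qed
  qed (simp add: X'_def)
qed

text \<open>Transmitter 2 uses only the levels from \<open>m\<close> up to \<open>n - m\<close>: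
  above them its signal would disturb receiver 1, below them it would be disturbed at receiver 2. No
  feedback is used, and if \<open>n \<le> 2 * m\<close> user 2 is silent.\<close>

lemma corner_avoid:
  assumes "m \<le> n"
  shows "corner n m (F11, F12, F21, F22) n (n - 2 * m)"
proof (intro cornerI)
  fix J
  define d where "d = n - m"
  define X :: "(nat \<Rightarrow> nat \<Rightarrow> bit, nat \<Rightarrow> nat \<Rightarrow> bit) signal" where "X a b = a" for a b
  define X' :: "(nat \<Rightarrow> nat \<Rightarrow> bit, nat \<Rightarrow> nat \<Rightarrow> bit) signal"
    where "X' b a k i = (if m \<le> i \<and> i < d then b k (i - m) else 0)" for b a k i
  have q: "max n m = n" "m + d = n" using assms by (auto simp: d_def)
  have Y: "rx n m X X' a b k i = a k i" if "i < n" for a b k i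
    using assms(1) that by (auto simp: rx_def chan_weak d_def X_def X'_def)
  have Y': "rx n m X' X b a k i = X' b a k i" if "i < d" for a b k i
    using assms(1) that by (simp add: rx_def chan_weak d_def)
  show "zero_error n m (F11, F12, F21, F22) (Suc J) (streams J n) (streams J (n - 2 * m)) X X'"
  proof (rule zero_errorI, unfold q)
    fix a a' b b'
    assume s: "a \<in> streams J n" "a' \<in> streams J n"
      and "\<forall>k<Suc J. \<forall>i<n. rx n m X X' a b k i = rx n m X X' a' b' k i"
    then show "a = a'" by (intro streams_eqI[OF s]) (simp add: Y)
  next
    fix a a' b b'
    assume s: "b \<in> streams J (n - 2 * m)" "b' \<in> streams J (n - 2 * m)"
      and y: "\<forall>k<Suc J. \<forall>i<n. rx n m X' X b a k i = rx n m X' X b' a' k i"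
    show "b = b'" using s
    proof (rule streams_eqI)
      fix k i assume *: "k < J" "i < n - 2 * m"
      then have "m + i < d" by (simp add: d_def)
      then show "b k i = b' k i"
        using y[rule_format, of k "m + i"] * q by (simp add: Y' X'_def)
    qed
  qed (simp_all add: X_def X'_def)
qed

section \<open>Corner points for strong interference\<close>

text \<open>The bits of user 2 travel over the cross link to receiver 1, where they arrive above the
  signal of user 1, then over the feedback to transmitter 1, and over the other cross link to
  receiver 2. Transmitter 1 relays them in its lowest \<open>m - n\<close> levels, which its own
  receiver does not see.\<close>

lemma corner_forward:
  assumes "n \<le> m"
  shows "corner n m (1, F12, F21, F22) n (m - n)"
proof (intro cornerI)
  fix J
  define d where "d = m - n"
  define X :: "(nat \<Rightarrow> nat \<Rightarrow> bit, nat \<Rightarrow> nat \<Rightarrow> bit) signal"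
    where "X a b k i = (if i < n then a k i else delay b k (i - n))" for a b k i
  define X' :: "(nat \<Rightarrow> nat \<Rightarrow> bit, nat \<Rightarrow> nat \<Rightarrow> bit) signal"
    where "X' b a k i = (if i < d then b k i else 0)" for b a k i
  have q: "max n m = m" "n + d = m" using assms by (auto simp: d_def)
  have Y: "rx n m X X' a b k i = (if d \<le> i then a k (i - d) else b k i)" if "i < m" for a b k i
    using assms that by (auto simp: rx_def chan_strong d_def X_def X'_def)
  have Y': "rx n m X' X b a k i = (if d \<le> i then X' b a k (i - d) else 0) + X a b k i" for a b k i
    using assms by (simp add: rx_def chan_strong d_def)
  show "zero_error n m (1, F12, F21, F22) (Suc J) (streams J n) (streams J (m - n)) X X'"
  proof (rule zero_errorI, unfold q)
    fix a b b' k
    assume y: "1 = (1 :: bit) \<Longrightarrow> \<forall>k'<k. \<forall>i<m. rx n m X X' a b k' i = rx n m X X' a b' k' i"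
    have "b k' i = b' k' i" if "k' < k" "i < d" for k' i
      using y[rule_format, of k' i] that q by (simp add: Y)
    then have "delay b k i = delay b' k i" if "i < d" for i
      using that by (intro delay_cong)
    then show "\<forall>i<m. X a b k i = X a b' k i"
      using q by (simp add: X_def)
  next
    fix a a' b b'
    assume s: "a \<in> streams J n" "a' \<in> streams J n"
      and y: "\<forall>k<Suc J. \<forall>i<m. rx n m X X' a b k i = rx n m X X' a' b' k i"
    show "a = a'" using s
    proof (rule streams_eqI)
      fix k i assume "k < J" "i < n"
      then show "a k i = a' k i" using y[rule_format, of k "i + d"] q by (simp add: Y)
    qed
  next
    fix a a' b b'
    assume s: "b \<in> streams J (m - n)" "b' \<in> streams J (m - n)"
      and y: "\<forall>k<Suc J. \<forall>i<m. rx n m X' X b a k i = rx n m X' X b' a' k i"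
    \<comment> \<open>In time unit \<open>k + 1\<close>, level \<open>n + i\<close> of receiver 2
      carries the relayed \<open>b k i\<close>, possibly plus a direct bit of block
      \<open>k + 1\<close>, known backwards.\<close>
    have "b k i = b' k i" if "i < d" for k i
      using s _ that
    proof (rule streams_backward)
      fix k i assume *: "k < J" "i < d" "\<And>i. i < d \<Longrightarrow> b (Suc k) i = b' (Suc k) i"
      have "X' b a (Suc k) i = X' b' a' (Suc k) i" for i
        using *(3) by (simp add: X'_def)
      then show "b k i = b' k i"
        using y[rule_format, of "Suc k" "n + i"] * q by (simp add: Y' X_def split: if_splits)
    qed
    then show "b = b'" using streams_eqI[OF s] by (simp add: d_def)
  qed (simp add: X'_def)
qed

text \<open>User 1 gives up its own rate and relays everything, so user 2 gets all \<open>m\<close>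
  levels of the cross links instead of the \<open>n\<close> levels of its direct link. Transmitter 1
  learns the bits forwards by subtracting its own signal; receiver 2 decodes backwards.\<close>

lemma corner_relay_all:
  assumes "n \<le> m"
  shows "corner n m (1, F12, F21, F22) 0 m"
proof (intro cornerI)
  fix J
  define d where "d = m - n"
  define X :: "(nat \<Rightarrow> nat \<Rightarrow> bit, nat \<Rightarrow> nat \<Rightarrow> bit) signal" where "X a b = delay b" for a b
  define X' :: "(nat \<Rightarrow> nat \<Rightarrow> bit, nat \<Rightarrow> nat \<Rightarrow> bit) signal" where "X' b a = b" for b a
  have q: "max n m = m" "n + d = m" using assms by (auto simp: d_def)
  have Y: "rx n m X X' a b k i = (if d \<le> i then delay b k (i - d) else 0) + b k i" for a b k i
    using assms by (simp add: rx_def chan_strong d_def X_def X'_def)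
  have Y': "rx n m X' X b a k i = (if d \<le> i then b k (i - d) else 0) + delay b k i" for a b k i
    using assms by (simp add: rx_def chan_strong d_def X_def X'_def)
  show "zero_error n m (1, F12, F21, F22) (Suc J) (streams J 0) (streams J m) X X'"
  proof (rule zero_errorI, unfold q)
    fix a b b' k
    assume y: "1 = (1 :: bit) \<Longrightarrow> \<forall>k'<k. \<forall>i<m. rx n m X X' a b k' i = rx n m X X' a b' k' i"
    have "b k' i = b' k' i" if "k' < k" "i < m" for k' i
      using that
    proof (induction k' arbitrary: i rule: less_induct)
      case (less k')
      have "delay b k' (i - d) = delay b' k' (i - d)"
        by (rule delay_cong) (use less in auto)
      then show ?case using y[rule_format, of k' i] less(2,3) by (simp add: Y split: if_splits)
    qed
    then have "delay b k i = delay b' k i" if "i < m" for i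
      using that by (intro delay_cong)
    then show "\<forall>i<m. X a b k i = X a b' k i" by (simp add: X_def)
  next
    fix a a' b b'
    assume s: "b \<in> streams J m" "b' \<in> streams J m"
      and y: "\<forall>k<Suc J. \<forall>i<m. rx n m X' X b a k i = rx n m X' X b' a' k i"
    have "b k i = b' k i" if "i < m" for k i
      using s _ that
    proof (rule streams_backward)
      fix k i assume *: "k < J" "i < m" "\<And>i. i < m \<Longrightarrow> b (Suc k) i = b' (Suc k) i"
      then show "b k i = b' k i"
        using y[rule_format, of "Suc k" i] by (simp add: Y' split: if_splits)
    qed
    then show "b = b'" using streams_eqI[OF s] by simp
  qed (auto simp: X'_def intro: streams_eqI)
qed

text \<open>Both users send in their top \<open>n\<close> levels. The interference arrives in the
  top \<open>n\<close> levels of a receiver and the wanted signal in its lowest \<open>n\<close>;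
  these are disjoint.\<close>

lemma corner_disjoint:
  assumes "2 * n \<le> m"
  shows "corner n m (F11, F12, F21, F22) n n"
proof (intro cornerI)
  fix J
  define d where "d = m - n"
  define X :: "(nat \<Rightarrow> nat \<Rightarrow> bit, nat \<Rightarrow> nat \<Rightarrow> bit) signal"
    where "X a b k i = (if i < n then a k i else 0)" for a b k i
  have q: "max n m = m" "n + d = m" "n \<le> d" using assms by (auto simp: d_def)
  have Y: "rx n m X X a b k (d + i) = a k i" if "i < n" for a b k i
    using q that by (simp add: rx_def chan_strong X_def flip: d_def)
  have dec: "a = a'" if s: "a \<in> streams J n" "a' \<in> streams J n"
      and y: "\<forall>k<Suc J. \<forall>i<m. rx n m X X a b k i = rx n m X X a' b' k i" for a a' b b'
    using s
  proof (rule streams_eqI)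
    fix k i assume "k < J" "i < n"
    then show "a k i = a' k i"
      using y[rule_format, of k "d + i"] q by (simp add: Y)
  qed
  show "zero_error n m (F11, F12, F21, F22) (Suc J) (streams J n) (streams J n) X X"
    by (rule zero_errorI, unfold q(1)) (auto simp: X_def intro: dec)
qed

text \<open>Transmitter 2 sends its bits periodically, so that one full period arrives at receiver 1 in
  the levels above those of transmitter 1, and one arrives at receiver 2 in the levels below them.\<close>

lemma corner_periodic:
  assumes "n < m" "m \<le> 2 * n"
  shows "corner n m (F11, F12, F21, F22) n (m - n)"
proof (intro cornerI)
  fix J
  define d where "d = m - n"
  define X :: "(nat \<Rightarrow> nat \<Rightarrow> bit, nat \<Rightarrow> nat \<Rightarrow> bit) signal"
    where "X a b k i = (if i < n then a k i else 0)" for a b k i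
  define X' :: "(nat \<Rightarrow> nat \<Rightarrow> bit, nat \<Rightarrow> nat \<Rightarrow> bit) signal"
    where "X' b a k i = (if i < n then b k (i mod d) else 0)" for b a k i
  have q: "max n m = m" "n + d = m" "d \<le> n" "0 < d" using assms by (auto simp: d_def)
  have Y: "rx n m X X' a b k i = (if d \<le> i then a k (i - d) else 0) + X' b a k i" if "i < m" for a b k i
    using assms that by (auto simp: rx_def chan_strong d_def X_def)
  have Y': "rx n m X' X b a k i = b k ((i - d) mod d)" if "n \<le> i" "i < m" for a b k i
    using assms that by (auto simp: rx_def chan_strong d_def X_def X'_def)
  show "zero_error n m (F11, F12, F21, F22) (Suc J) (streams J n) (streams J (m - n)) X X'"
  proof (rule zero_errorI, unfold q(1))
    fix a a' b b'
    assume s: "a \<in> streams J n" "a' \<in> streams J n"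
      and "\<forall>k<Suc J. \<forall>i<m. rx n m X X' a b k i = rx n m X X' a' b' k i"
    then have y: "rx n m X X' a b k i = rx n m X X' a' b' k i" if "k \<le> J" "i < m" for k i
      using that by auto
    \<comment> \<open>The own signal of receiver 1 starts at level \<open>d\<close>, so the first
      period of \<open>X'\<close> arrives cleanly above it and determines all of \<open>X'\<close>,
      which is then subtracted.\<close>
    have "b k i = b' k i" if "k \<le> J" "i < d" for k i
      using y[of k i] q that by (simp add: Y X'_def)
    then have X': "X' b a k i = X' b' a' k i" if "k \<le> J" for k i
      using that q by (simp add: X'_def)
    show "a = a'" using s
    proof (rule streams_eqI)
      fix k i assume *: "k < J" "i < n"
      have "X' b a k (i + d) = X' b' a' k (i + d)"
        using X' * by simp
      then show "a k i = a' k i"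
        using y[of k "i + d"] * q by (simp add: Y)
    qed
  next
    fix a a' b b'
    assume s: "b \<in> streams J (m - n)" "b' \<in> streams J (m - n)"
      and y: "\<forall>k<Suc J. \<forall>i<m. rx n m X' X b a k i = rx n m X' X b' a' k i"
    show "b = b'" using s
    proof (rule streams_eqI)
      fix k i assume *: "k < J" "i < m - n"
      then have i: "i < d" by (simp add: d_def)
      \<comment> \<open>Levels \<open>n..<m\<close> of receiver 2 show the last \<open>d\<close>
        used levels of \<open>X'\<close>, a window in which every residue modulo \<open>d\<close>
        occurs.\<close>
      obtain t where t: "n \<le> t + d" "t < n" "t mod d = i"
      proof
        define r where "r = n - d"
        let ?t = "r + (i + (d - r mod d)) mod d"
        have "(i + (d - r mod d)) mod d < d" "r + d = n" using q by (simp_all add: r_def)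
        then show "n \<le> ?t + d" "?t < n" by linarith+
        have "?t mod d = (r mod d + (i + (d - r mod d))) mod d" by (simp add: mod_simps)
        also have "r mod d + (i + (d - r mod d)) = i + d"
          using q mod_less_divisor[of d r] by linarith
        finally show "?t mod d = i" using i by simp
      qed
      then show "b k i = b' k i"
        using y[rule_format, of k "t + d"] * q by (simp add: Y')
    qed
  qed (simp_all add: X_def X'_def)
qed

section \<open>Time sharing\<close>

text \<open>The codes run one after the other on pairs of messages. Equality of the joint outputs
  splits into equality in each phase, which reduces causality and decodability to the two given
  codes.\<close>

lemma codable_append:
  assumes "codable n m F N M1 M2" "codable n m F N' M1' M2'"
  shows "codable n m F (N + N') (M1 * M1') (M2 * M2')"
proof -
  let ?q = "max n m"
  obtain X X' where Z: "zero_error n m F N {1..M1} {1..M2} X X'"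
    using assms(1) unfolding codable_def by blast
  obtain V V' where W: "zero_error n m F N' {1..M1'} {1..M2'} V V'"
    using assms(2) unfolding codable_def by blast
  obtain F11 F12 F21 F22 where F: "F = (F11, F12, F21, F22)" by (metis prod_cases4)
  define app :: "(nat, nat) signal \<Rightarrow> (nat, nat) signal \<Rightarrow> (nat \<times> nat, nat \<times> nat) signal" where
    "app X V = (\<lambda>a b k. if k < N then X (fst a) (fst b) k else V (snd a) (snd b) (k - N))" for X V
  have rx: "rx n m (app X V) (app X' V') = app (rx n m X X') (rx n m V V')" for X X' V V'
    by (auto simp: rx_def app_def fun_eq_iff)
  have same: "same ?q k (app X V a b) (app X V a' b') \<longleftrightarrow>
      same ?q (min k N) (X (fst a) (fst b)) (X (fst a') (fst b')) \<and>
      same ?q (k - N) (V (snd a) (snd b)) (V (snd a') (snd b'))" for k X V a b a' b'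
  proof (intro iffI conjI)
    assume *: "same ?q k (app X V a b) (app X V a' b')"
    show "same ?q (min k N) (X (fst a) (fst b)) (X (fst a') (fst b'))" unfolding same_def
    proof (intro allI impI)
      fix t i assume "t < min k N" "i < ?q"
      then show "X (fst a) (fst b) t i = X (fst a') (fst b') t i"
        using *[unfolded same_def, rule_format, of t i] by (simp add: app_def)
    qed
    show "same ?q (k - N) (V (snd a) (snd b)) (V (snd a') (snd b'))" unfolding same_def
    proof (intro allI impI)
      fix t i assume "t < k - N" "i < ?q"
      then show "V (snd a) (snd b) t i = V (snd a') (snd b') t i"
        using *[unfolded same_def, rule_format, of "N + t" i] by (simp add: app_def)
    qed
  qed (simp add: same_def app_def)
  have caus: "causal n m Fo Fc (N + N') (A \<times> A') (B \<times> B') (app X V) (app X' V')"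
    if "causal n m Fo Fc N A B X X'" "causal n m Fo Fc N' A' B' V V'" for Fo Fc A A' B B' X X' V V'
    unfolding causal_def
  proof (intro ballI allI impI)
    fix a b b' k i
    assume *: "a \<in> A \<times> A'" "b \<in> B \<times> B'" "b' \<in> B \<times> B'" "k < N + N'" "i < ?q"
      "Fo = 1 \<longrightarrow> same ?q k (rx n m (app X V) (app X' V') a b) (rx n m (app X V) (app X' V') a b')"
      "Fc = 1 \<longrightarrow> same ?q k (rx n m (app X' V') (app X V) b a) (rx n m (app X' V') (app X V) b' a)"
    have fb: "Fo = 1 \<Longrightarrow> same ?q (min k N) (rx n m X X' (fst a) (fst b)) (rx n m X X' (fst a) (fst b'))"
      "Fc = 1 \<Longrightarrow> same ?q (min k N) (rx n m X' X (fst b) (fst a)) (rx n m X' X (fst b') (fst a))"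
      "Fo = 1 \<Longrightarrow> same ?q (k - N) (rx n m V V' (snd a) (snd b)) (rx n m V V' (snd a) (snd b'))"
      "Fc = 1 \<Longrightarrow> same ?q (k - N) (rx n m V' V (snd b) (snd a)) (rx n m V' V (snd b') (snd a))"
      using *(6,7) unfolding rx same by blast+
    have mem: "fst a \<in> A" "snd a \<in> A'" "fst b \<in> B" "snd b \<in> B'" "fst b' \<in> B" "snd b' \<in> B'"
      using *(1-3) by (simp_all add: mem_Times_iff)
    show "app X V a b k i = app X V a b' k i"
    proof (cases "k < N")
      case True
      then have k: "min k N = k" by simp
      have "X (fst a) (fst b) k i = X (fst a) (fst b') k i"
        using that(1)[unfolded causal_def] mem(1,3,5) True *(5) fb(1,2)[unfolded k] by blast
      then show ?thesis using True by (simp add: app_def)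
    next
      case False
      then have k: "k - N < N'" using *(4) by linarith
      have "V (snd a) (snd b) (k - N) i = V (snd a) (snd b') (k - N) i"
        using that(2)[unfolded causal_def] mem(2,4,6) k *(5) fb(3,4) by blast
      then show ?thesis using False by (simp add: app_def)
    qed
  qed
  have dec: "decodable n m (N + N') ((A \<times> A') \<times> (B \<times> B')) (app X V) (app X' V')"
    if "decodable n m N (A \<times> B) X X'" "decodable n m N' (A' \<times> B') V V'" for A A' B B' X X' V V'
  proof -
    have "a = c"
      if *: "a \<in> A \<times> A'" "b \<in> B \<times> B'" "c \<in> A \<times> A'" "d \<in> B \<times> B'"
        and "same ?q (N + N') (app (rx n m X X') (rx n m V V') a b) (app (rx n m X X') (rx n m V V') c d)"
      for a b c d
    proof -
      have s: "same ?q N (rx n m X X' (fst a) (fst b)) (rx n m X X' (fst c) (fst d))"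
        "same ?q N' (rx n m V V' (snd a) (snd b)) (rx n m V V' (snd c) (snd d))"
        using that(5) unfolding same by simp_all
      have mem: "(fst a, fst b) \<in> A \<times> B" "(fst c, fst d) \<in> A \<times> B"
        "(snd a, snd b) \<in> A' \<times> B'" "(snd c, snd d) \<in> A' \<times> B'"
        using * by (simp_all add: mem_Times_iff)
      have "fst a = fst c"
        using \<open>decodable n m N (A \<times> B) X X'\<close> mem(1,2) s(1) unfolding decodable_def by blast
      moreover have "snd a = snd c"
        using \<open>decodable n m N' (A' \<times> B') V V'\<close> mem(3,4) s(2) unfolding decodable_def by blast
      ultimately show ?thesis by (rule prod_eqI)
    qed
    then show ?thesis unfolding decodable_def rx by blast
  qed
  have "zero_error n m F (N + N') ({1..M1} \<times> {1..M1'}) ({1..M2} \<times> {1..M2'}) (app X V) (app X' V')"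
    using Z W unfolding zero_error_def F prod.case by (intro conjI caus dec) blast+
  then show ?thesis
    by (rule codableI) (simp_all add: card_cartesian_product)
qed

section \<open>From signals to encoders and decoders\<close>

lemma vec_cong: "(\<And>i. i < q \<Longrightarrow> x i = y i) \<Longrightarrow> vec q x = vec q y"
  by (intro eq_vecI) auto

lemma map_vec_eq_iff_same:
  "map (\<lambda>k. vec q (y k)) [0..<N] = map (\<lambda>k. vec q (y' k)) [0..<N] \<longleftrightarrow> same q N y y'"
proof
  assume eq: "map (\<lambda>k. vec q (y k)) [0..<N] = map (\<lambda>k. vec q (y' k)) [0..<N]"
  show "same q N y y'" unfolding same_def
  proof (intro allI impI)
    fix k i assume "k < N" "i < q"
    then have "map (\<lambda>k. vec q (y k)) [0..<N] ! k $ i = map (\<lambda>k. vec q (y' k)) [0..<N] ! k $ i"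
      by (simp add: eq)
    then show "y k i = y' k i" using \<open>k < N\<close> \<open>i < q\<close> by simp
  qed
next
  assume "same q N y y'"
  then show "map (\<lambda>k. vec q (y k)) [0..<N] = map (\<lambda>k. vec q (y' k)) [0..<N]"
    by (auto simp: same_def intro!: vec_cong)
qed

lemma feedback_map_eq_iff_same:
  "feedback f (map (\<lambda>k. vec q (y k)) [0..<N]) = feedback f (map (\<lambda>k. vec q (y' k)) [0..<N]) \<longleftrightarrow>
     (f = 1 \<longrightarrow> same q N y y')"
  by (cases "f = 1") (simp_all add: feedback_def map_vec_eq_iff_same del: map_eq_conv)

abbreviation received :: "nat \<Rightarrow> nat \<Rightarrow> ('a, 'b) signal \<Rightarrow> ('b, 'a) signal \<Rightarrow> 'a \<Rightarrow> 'b \<Rightarrow> nat \<Rightarrow> f2vec list" where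
  "received n m X X' a b N \<equiv> map (\<lambda>k. vec (max n m) (rx n m X X' a b k)) [0..<N]"

text \<open>A causal signal is the output of an encoder: the other message enters only through the feedback,
  so any other message consistent with the feedback seen so far may be used in its place.\<close>

definition encoder_of ::
  "nat \<Rightarrow> nat \<Rightarrow> bit \<Rightarrow> bit \<Rightarrow> nat set \<Rightarrow> (nat, nat) signal \<Rightarrow> (nat, nat) signal \<Rightarrow>
     nat \<Rightarrow> nat \<Rightarrow> f2vec list \<Rightarrow> f2vec list \<Rightarrow> f2vec"
where
  "encoder_of n m Fo Fc B X X' t a ys ys' =
     vec (max n m) (X a (SOME b. b \<in> B \<and> feedback Fo (received n m X X' a b (t - 1)) = ys \<and>
                                 feedback Fc (received n m X' X b a (t - 1)) = ys') (t - 1))"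

text \<open>The message picked by \<open>SOME\<close> need not be \<open>b\<close>, but it produces
  the same feedback, so by causality the same bits are sent.\<close>

lemma encoder_of_eq:
  assumes "causal n m Fo Fc N A B X X'" "a \<in> A" "b \<in> B" "k < N"
  shows "encoder_of n m Fo Fc B X X' (Suc k) a (feedback Fo (received n m X X' a b k))
           (feedback Fc (received n m X' X b a k)) = vec (max n m) (X a b k)"
proof -
  define b' where "b' = (SOME b'. b' \<in> B \<and>
      feedback Fo (received n m X X' a b' k) = feedback Fo (received n m X X' a b k) \<and>
      feedback Fc (received n m X' X b' a k) = feedback Fc (received n m X' X b a k))"
  have "b' \<in> B \<and> feedback Fo (received n m X X' a b' k) = feedback Fo (received n m X X' a b k) \<and>
      feedback Fc (received n m X' X b' a k) = feedback Fc (received n m X' X b a k)"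
    unfolding b'_def by (rule someI[of _ b]) (use assms in auto)
  then have "\<forall>i<max n m. X a b' k i = X a b k i"
    using assms unfolding causal_def feedback_map_eq_iff_same by blast
  then show ?thesis
    unfolding encoder_of_def diff_Suc_1 b'_def[symmetric] by (intro vec_cong) auto
qed

text \<open>By induction on time, the run of the constructed encoders reproduces the signals. A
  decoder picks any message consistent with its output, and \<open>decodable\<close> makes this
  choice the true one.\<close>

lemma codable_encoders:
  assumes "codable n m F N M1 M2"
  shows "\<exists>f1 f2 h1 h2. is_encoder (max n m) f1 \<and> is_encoder (max n m) f2 \<and>
    (\<forall>w1\<in>{1..M1}. \<forall>w2\<in>{1..M2}. h1 (fst (outputs n m F f1 f2 w1 w2 N)) = w1 \<and>
        h2 (snd (outputs n m F f1 f2 w1 w2 N)) = w2)"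
proof -
  let ?A = "{1..M1}" and ?B = "{1..M2}"
  obtain F11 F12 F21 F22 where F: "F = (F11, F12, F21, F22)" by (metis prod_cases4)
  obtain X X' where "zero_error n m F N ?A ?B X X'"
    using assms unfolding codable_def by blast
  then have c: "causal n m F11 F21 N ?A ?B X X'" "causal n m F22 F12 N ?B ?A X' X"
    and d: "decodable n m N (?A \<times> ?B) X X'" "decodable n m N (?B \<times> ?A) X' X"
    by (auto simp: zero_error_def F)
  define f1 where "f1 = encoder_of n m F11 F21 ?B X X'"
  define f2 where "f2 t w ys1 ys2 = encoder_of n m F22 F12 ?A X' X t w ys2 ys1" for t w ys1 ys2
  define h1 where "h1 ys = (SOME a. \<exists>b\<in>?B. a \<in> ?A \<and> received n m X X' a b N = ys)" for ys
  define h2 where "h2 ys = (SOME b. \<exists>a\<in>?A. b \<in> ?B \<and> received n m X' X b a N = ys)" for ys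
  have out: "outputs n m F f1 f2 a b k = (received n m X X' a b k, received n m X' X b a k)"
    if "a \<in> ?A" "b \<in> ?B" "k \<le> N" for a b k
    using that(3)
  proof (induction k)
    case (Suc k)
    have "f1 (Suc k) a (feedback F11 (received n m X X' a b k)) (feedback F21 (received n m X' X b a k))
          = vec (max n m) (X a b k)"
      unfolding f1_def using encoder_of_eq[OF c(1) that(1,2)] Suc by simp
    moreover have "f2 (Suc k) b (feedback F12 (received n m X X' a b k)) (feedback F22 (received n m X' X b a k))
          = vec (max n m) (X' b a k)"
      unfolding f2_def using encoder_of_eq[OF c(2) that(2,1)] Suc by simp
    moreover have "chan n m (X a b k) (X' b a k) = rx n m X X' a b k"
      "chan n m (X' b a k) (X a b k) = rx n m X' X b a k" by (auto simp: rx_def fun_eq_iff)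
    ultimately show ?case
      using Suc by (simp add: F Let_def channel_output_vec)
  qed simp
  have h1: "h1 (received n m X X' a b N) = a" if "a \<in> ?A" "b \<in> ?B" for a b
  proof -
    have "\<exists>b'\<in>?B. h1 (received n m X X' a b N) \<in> ?A \<and>
        received n m X X' (h1 (received n m X X' a b N)) b' N = received n m X X' a b N"
      unfolding h1_def[of "received n m X X' a b N"]
      by (rule someI_ex) (use that in blast)
    then show ?thesis
      using d(1) that unfolding decodable_def map_vec_eq_iff_same by blast
  qed
  have h2: "h2 (received n m X' X b a N) = b" if "a \<in> ?A" "b \<in> ?B" for a b
  proof -
    have "\<exists>a'\<in>?A. h2 (received n m X' X b a N) \<in> ?B \<and>
        received n m X' X (h2 (received n m X' X b a N)) a' N = received n m X' X b a N"
      unfolding h2_def[of "received n m X' X b a N"]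
      by (rule someI_ex) (use that in blast)
    then show ?thesis
      using d(2) that unfolding decodable_def map_vec_eq_iff_same by blast
  qed
  have "is_encoder (max n m) f1" "is_encoder (max n m) f2"
    by (auto simp: is_encoder_def f1_def f2_def encoder_of_def)
  then show ?thesis
    by (intro exI[of _ f1] exI[of _ f2] exI[of _ h1] exI[of _ h2]) (auto simp: out h1 h2)
qed

section \<open>Achievable rates from zero-error codes\<close>

lemma messages_eq: "messages N R = {1..nat \<lfloor>2 powr (real N * R)\<rfloor>}"
proof -
  have "real w \<le> x \<longleftrightarrow> w \<le> nat \<lfloor>x\<rfloor>" if "1 \<le> w" for w x
    using that le_floor_iff[of "int w" x] by (simp add: le_nat_iff) linarith
  then show ?thesis by (auto simp: messages_def)
qed

lemma finite_messages [simp]: "finite (messages N R)"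
  by (simp add: messages_eq)

lemma one_le_powr: "0 \<le> R \<Longrightarrow> 1 \<le> 2 powr (real N * R)"
  using ge_one_powr_ge_zero[of 2 "real N * R"] by simp

lemma messages_nonempty: "0 \<le> R \<Longrightarrow> messages N R \<noteq> {}"
  using one_le_powr[of R N] by (auto simp: messages_def intro!: exI[of _ 1])

text \<open>Rounding down a real number that is at least 1 loses less than a factor 2.\<close>

lemma card_messages_ge: "0 \<le> R \<Longrightarrow> 2 powr (real N * R) \<le> 2 * real (card (messages N R))"
proof -
  define x where "x = 2 powr (real N * R)"
  assume "0 \<le> R"
  then have "1 \<le> \<lfloor>x\<rfloor>" using one_le_powr[of R N] by (simp add: x_def)
  moreover from this have "x \<le> 2 * of_int \<lfloor>x\<rfloor>" by linarith
  ultimately show ?thesis by (simp add: messages_eq flip: x_def)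
qed

lemma set_message_pmf:
  "0 \<le> R1 \<Longrightarrow> 0 \<le> R2 \<Longrightarrow> set_pmf (message_pmf N R1 R2) = messages N R1 \<times> messages N R2"
  by (simp add: message_pmf_def messages_nonempty)

lemma message_pmf_eq:
  assumes "0 \<le> R1" "0 \<le> R2"
  shows "message_pmf N R1 R2 = pmf_of_set (messages N R1 \<times> messages N R2)"
proof (rule pmf_eqI)
  fix p :: "nat \<times> nat"
  obtain a b where "p = (a, b)" by (cases p)
  then show "pmf (message_pmf N R1 R2) p = pmf (pmf_of_set (messages N R1 \<times> messages N R2)) p"
    using assms by (simp add: message_pmf_def pmf_pair messages_nonempty card_cartesian_product indicator_def)
qed

text \<open>The error probability is exactly 0 from some \<open>N0\<close> on; for smaller
  \<open>N\<close> dummy codes fill the sequence.\<close>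

lemma achievableI:
  assumes R: "0 \<le> R1" "0 \<le> R2"
    and "eventually (\<lambda>N. \<exists>M1 M2. codable n m F N M1 M2 \<and>
           2 powr (real N * R1) \<le> real M1 \<and> 2 powr (real N * R2) \<le> real M2) sequentially"
  shows "achievable n m F R1 R2"
proof -
  let ?A = "\<lambda>N. messages N R1" and ?B = "\<lambda>N. messages N R2"
  obtain N0 where N0: "\<And>N. N0 \<le> N \<Longrightarrow> \<exists>M1 M2. codable n m F N M1 M2 \<and>
           2 powr (real N * R1) \<le> real M1 \<and> 2 powr (real N * R2) \<le> real M2"
    using assms(3) by (auto simp: eventually_sequentially)
  define P where "P N f1 f2 h1 h2 \<longleftrightarrow> is_encoder (max n m) f1 \<and> is_encoder (max n m) f2 \<and>
      (N0 \<le> N \<longrightarrow> (\<forall>w1\<in>?A N. \<forall>w2\<in>?B N. h1 (fst (outputs n m F f1 f2 w1 w2 N)) = w1 \<and>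
        h2 (snd (outputs n m F f1 f2 w1 w2 N)) = w2))" for N f1 f2 h1 h2
  have "\<forall>N. \<exists>f1 f2 h1 h2. P N f1 f2 h1 h2"
  proof
    fix N
    show "\<exists>f1 f2 h1 h2. P N f1 f2 h1 h2"
    proof (cases "N0 \<le> N")
      case True
      then obtain M1 M2 where M: "codable n m F N M1 M2"
        "2 powr (real N * R1) \<le> real M1" "2 powr (real N * R2) \<le> real M2" using N0 by blast
      then have sub: "?A N \<subseteq> {1..M1}" "?B N \<subseteq> {1..M2}" by (auto simp: messages_def)
      obtain f1 f2 h1 h2 where "is_encoder (max n m) f1" "is_encoder (max n m) f2"
        "\<forall>w1\<in>{1..M1}. \<forall>w2\<in>{1..M2}. h1 (fst (outputs n m F f1 f2 w1 w2 N)) = w1 \<and>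
          h2 (snd (outputs n m F f1 f2 w1 w2 N)) = w2"
        using codable_encoders[OF M(1)] by (elim exE conjE)
      then have "P N f1 f2 h1 h2"
        unfolding P_def using sub by (intro conjI impI ballI) (simp_all add: subset_iff)
      then show ?thesis by (intro exI)
    next
      case False
      then have "P N (\<lambda>_ _ _ _. 0\<^sub>v (max n m)) (\<lambda>_ _ _ _. 0\<^sub>v (max n m)) (\<lambda>_. 0) (\<lambda>_. 0)"
        by (simp add: P_def is_encoder_def)
      then show ?thesis by (intro exI)
    qed
  qed
  from choice[OF this] obtain f1 where "\<forall>N. \<exists>f2 h1 h2. P N (f1 N) f2 h1 h2" ..
  from choice[OF this] obtain f2 where "\<forall>N. \<exists>h1 h2. P N (f1 N) (f2 N) h1 h2" ..
  from choice[OF this] obtain h1 where "\<forall>N. \<exists>h2. P N (f1 N) (f2 N) (h1 N) h2" ..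
  from choice[OF this] obtain h2 where P: "\<forall>N. P N (f1 N) (f2 N) (h1 N) (h2 N)" ..
  have enc: "\<forall>N. is_encoder (max n m) (f1 N) \<and> is_encoder (max n m) (f2 N)"
    using P by (simp add: P_def)
  have "measure_pmf.prob (message_pmf N R1 R2)
           {(w1, w2). h1 N (fst (outputs n m F (f1 N) (f2 N) w1 w2 N)) \<noteq> w1} = 0 \<and>
       measure_pmf.prob (message_pmf N R1 R2)
           {(w1, w2). h2 N (snd (outputs n m F (f1 N) (f2 N) w1 w2 N)) \<noteq> w2} = 0" if "N0 \<le> N" for N
    using P[rule_format, of N] that unfolding P_def measure_pmf_zero_iff set_message_pmf[OF R] by auto
  then have "eventually (\<lambda>N. measure_pmf.prob (message_pmf N R1 R2)
           {(w1, w2). h1 N (fst (outputs n m F (f1 N) (f2 N) w1 w2 N)) \<noteq> w1} = 0) sequentially"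
       "eventually (\<lambda>N. measure_pmf.prob (message_pmf N R1 R2)
           {(w1, w2). h2 N (snd (outputs n m F (f1 N) (f2 N) w1 w2 N)) \<noteq> w2} = 0) sequentially"
    unfolding eventually_sequentially by (intro exI[of _ N0]; simp)+
  note lim = this[THEN tendsto_eventually]
  show ?thesis unfolding achievable_def
    by (intro conjI R exI[of _ f1] exI[of _ f2] exI[of _ h1] exI[of _ h2] enc lim)
qed

text \<open>\<open>N - 2\<close>, since each of the two corner schemes spends one extra time unit;
  the rest is divided into blocks in the proportion \<open>l\<close>. The case \<open>R = 0\<close>
  is separate because the mixed rate itself may be 0, and then no \<open>R\<close> lies strictly
  below it.\<close>

lemma time_sharing_rate:
  fixes r s :: nat and l R :: real
  assumes "0 \<le> l" "l \<le> 1" "R = 0 \<or> R < l * r + (1 - l) * s"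
  shows "eventually (\<lambda>N. 2 powr (real N * R) \<le>
           real (2 ^ (nat \<lfloor>l * real (N - 2)\<rfloor> * r) * 2 ^ ((N - 2 - nat \<lfloor>l * real (N - 2)\<rfloor>) * s))) sequentially"
  using assms(3)
proof
  assume "R = 0"
  then show ?thesis by (simp flip: power_add)
next
  define t where "t = l * r + (1 - l) * s"
  assume "R < l * r + (1 - l) * s"
  then have "0 < t - R" by (simp add: t_def)
  then have "filterlim (\<lambda>N. (t - R) * real N) at_top sequentially"
    by (intro filterlim_tendsto_pos_mult_at_top[OF tendsto_const] filterlim_real_sequentially)
  \<comment> \<open>\<open>2 * t\<close> pays for the two extra time units and \<open>r\<close> for
    the block lost by rounding down.\<close>
  then have ev: "eventually (\<lambda>N. 2 * t + r \<le> (t - R) * real N) sequentially"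
    by (simp add: filterlim_at_top)
  from ev eventually_ge_at_top[of 2] show ?thesis
  proof eventually_elim
    case (elim N)
    define J where "J = nat \<lfloor>l * real (N - 2)\<rfloor>"
    have J: "l * (real N - 2) - 1 \<le> real J" "real J \<le> l * (real N - 2)"
      using assms(1) elim(2) by (auto simp: J_def of_nat_diff)
    have "l * (real N - 2) \<le> real N - 2" using assms(2) elim(2) by (intro mult_left_le_one_le) (use assms in auto)
    with J(2) elim(2) have K: "real (N - 2 - J) = real N - 2 - real J" by (simp add: of_nat_diff)
    have "real N * R \<le> real N * t - 2 * t - r" using elim(1) by (simp add: algebra_simps)
    also have "\<dots> = (l * (real N - 2) - 1) * r + ((1 - l) * (real N - 2)) * s"
      by (simp add: t_def algebra_simps)
    also have "\<dots> \<le> real J * r + (real N - 2 - real J) * s"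
      using J by (intro add_mono mult_right_mono) (auto simp: algebra_simps)
    also have "\<dots> = real (J * r + (N - 2 - J) * s)"
      by (simp only: K of_nat_add of_nat_mult)
    finally have "2 powr (real N * R) \<le> 2 powr (real (J * r + (N - 2 - J) * s))"
      by simp
    then show ?case by (simp only: powr_realpow J_def[symmetric] power_add zero_less_numeral of_nat_power of_nat_mult of_nat_numeral)
  qed
qed

text \<open>Lowering each rate by 1/(k+1), but not below 0, gives the strict inequality that time
  sharing needs; the closure restores the limit.\<close>

lemma capacity_regionI:
  fixes l R1 R2 :: real and r1 r2 s1 s2 :: nat
  assumes "corner n m F r1 r2" "corner n m F s1 s2" "0 \<le> l" "l \<le> 1"
    and R: "0 \<le> R1" "0 \<le> R2" "R1 \<le> l * r1 + (1 - l) * s1" "R2 \<le> l * r2 + (1 - l) * s2"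
  shows "(R1, R2) \<in> capacity_region n m F"
proof -
  have ach: "achievable n m F Q1 Q2"
    if "0 \<le> Q1" "0 \<le> Q2" "Q1 = 0 \<or> Q1 < l * r1 + (1 - l) * s1" "Q2 = 0 \<or> Q2 < l * r2 + (1 - l) * s2" for Q1 Q2
  proof (rule achievableI[OF that(1,2)])
    from time_sharing_rate[OF assms(3,4) that(3)] time_sharing_rate[OF assms(3,4) that(4)]
      eventually_ge_at_top[of 2]
    show "eventually (\<lambda>N. \<exists>M1 M2. codable n m F N M1 M2 \<and>
           2 powr (real N * Q1) \<le> real M1 \<and> 2 powr (real N * Q2) \<le> real M2) sequentially"
    proof eventually_elim
      case (elim N)
      define J where "J = nat \<lfloor>l * real (N - 2)\<rfloor>"
      have "l * real (N - 2) \<le> real (N - 2)" by (intro mult_left_le_one_le) (use assms in auto)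
      then have "J \<le> N - 2" by (simp add: J_def nat_le_iff floor_le_iff)
      then have N: "Suc J + Suc (N - 2 - J) = N" using elim(3) by simp
      have "codable n m F N (2 ^ (J * r1) * 2 ^ ((N - 2 - J) * s1)) (2 ^ (J * r2) * 2 ^ ((N - 2 - J) * s2))"
        using codable_append[OF assms(1)[unfolded corner_def, rule_format, of J]
            assms(2)[unfolded corner_def, rule_format, of "N - 2 - J"]]
        unfolding N .
      then show ?case using elim(1,2) unfolding J_def by (intro exI conjI)
    qed
  qed
  define Q where "Q R k = max 0 (R - 1 / real (Suc k))" for R k
  have lim: "Q R \<longlonglongrightarrow> R" if "0 \<le> R" for R
  proof -
    have "(\<lambda>k. max 0 (R - 1 / real (Suc k))) \<longlonglongrightarrow> max 0 (R - 0)"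
      using LIMSEQ_inverse_real_of_nat
      by (intro tendsto_max tendsto_diff tendsto_const) (simp add: inverse_eq_divide)
    then show ?thesis using that by (simp add: Q_def[abs_def])
  qed
  have small: "0 \<le> Q R k \<and> (Q R k = 0 \<or> Q R k < t)" if "R \<le> t" for R t k
  proof -
    have "0 < 1 / real (Suc k)" by simp
    with that show ?thesis unfolding Q_def by linarith
  qed
  have "(Q R1 k, Q R2 k) \<in> {(R1, R2). achievable n m F R1 R2}" for k
    using ach[of "Q R1 k" "Q R2 k"] small[OF R(3), of k] small[OF R(4), of k] by simp
  moreover have "(\<lambda>k. (Q R1 k, Q R2 k)) \<longlonglongrightarrow> (R1, R2)"
    using lim R by (intro tendsto_Pair) auto
  ultimately show ?thesis
    unfolding capacity_region_def closure_sequential by (intro exI conjI allI)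
qed

text \<open>The last premise says that the point lies on or below the line through \<open>p\<close>
  and \<open>s\<close>. The weight \<open>l\<close> picks the point of the segment with first
  coordinate \<open>R1\<close>; left of \<open>s\<close>, the endpoint \<open>s\<close> itself
  dominates.\<close>

lemma segment_dominates:
  fixes p1 p2 s1 s2 R1 R2 :: real
  assumes "s1 \<le> p1" "p2 \<le> s2" "R1 \<le> p1" "R2 \<le> s2"
    and line: "(s2 - p2) * R1 + (p1 - s1) * R2 \<le> (s2 - p2) * p1 + (p1 - s1) * p2"
  obtains l where "0 \<le> l" "l \<le> 1" "R1 \<le> l * p1 + (1 - l) * s1" "R2 \<le> l * p2 + (1 - l) * s2"
proof (cases "R1 \<le> s1")
  case True
  then show ?thesis using assms that[of 0] by simp
next
  case False
  define l where "l = (R1 - s1) / (p1 - s1)"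
  have pos: "0 < p1 - s1" using False assms by simp
  have l: "l * (p1 - s1) = R1 - s1" using pos by (simp add: l_def)
  have "(p1 - s1) * R2 \<le> (p1 - s1) * (l * p2 + (1 - l) * s2)"
  proof -
    have "(p1 - s1) * (l * p2 + (1 - l) * s2) = (p1 - s1) * s2 - (l * (p1 - s1)) * (s2 - p2)"
      by (simp add: algebra_simps)
    also have "\<dots> = (p1 - s1) * s2 - (R1 - s1) * (s2 - p2)" by (simp only: l)
    finally show ?thesis using line by (simp add: algebra_simps)
  qed
  then have "R2 \<le> l * p2 + (1 - l) * s2" using pos by simp
  moreover have "R1 \<le> l * p1 + (1 - l) * s1" using l by (simp add: algebra_simps)
  ultimately show ?thesis using that[of l] pos False assms by (simp add: l_def)
qed

lemma capacity_region_segment: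
  fixes R1 R2 :: real and r1 r2 s1 s2 :: nat
  assumes "corner n m F r1 r2" "corner n m F s1 s2" "0 \<le> R1" "0 \<le> R2"
    and "s1 \<le> r1" "r2 \<le> s2" "R1 \<le> real r1" "R2 \<le> real s2"
    and "(real s2 - real r2) * R1 + (real r1 - real s1) * R2
           \<le> (real s2 - real r2) * real r1 + (real r1 - real s1) * real r2"
  shows "(R1, R2) \<in> capacity_region n m F"
proof -
  obtain l :: real where "0 \<le> l" "l \<le> 1" "R1 \<le> l * r1 + (1 - l) * s1" "R2 \<le> l * r2 + (1 - l) * s2"
    by (rule segment_dominates[of "real s1" "real r1" "real r2" "real s2" R1 R2])
      (use assms(5-9) in simp_all)
  then show ?thesis by (rule capacity_regionI[OF assms(1,2) _ _ assms(3,4)])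
qed

section \<open>Converse\<close>

text \<open>The substitute for entropy: each bound below names \<open>L\<close> bits per time unit
  and shows that they determine the messages.\<close>

lemma card_le_bits:
  fixes \<phi> :: "'s \<Rightarrow> nat \<Rightarrow> nat \<Rightarrow> bit"
  assumes "\<And>s s'. s \<in> S \<Longrightarrow> s' \<in> S \<Longrightarrow> \<forall>k<N. \<forall>i<L. \<phi> s k i = \<phi> s' k i \<Longrightarrow> s = s'"
  shows "card S \<le> 2 ^ (N * L)"
proof -
  define f where "f s = {(k, i). k < N \<and> i < L \<and> \<phi> s k i = 1}" for s
  have "inj_on f S"
  proof (rule inj_onI)
    fix s s' assume s: "s \<in> S" "s' \<in> S" and "f s = f s'"
    have "\<phi> s k i = \<phi> s' k i" if "k < N" "i < L" for k i
    proof -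
      have "(k, i) \<in> f s \<longleftrightarrow> (k, i) \<in> f s'" using \<open>f s = f s'\<close> by simp
      then have "\<phi> s k i = 1 \<longleftrightarrow> \<phi> s' k i = 1" using that by (simp add: f_def)
      then show ?thesis by (cases "\<phi> s k i"; cases "\<phi> s' k i") simp_all
    qed
    then show "s = s'" using assms[OF s] by simp
  qed
  moreover have "f ` S \<subseteq> Pow ({..<N} \<times> {..<L})" by (auto simp: f_def)
  ultimately have "card S \<le> card (Pow ({..<N} \<times> {..<L}))" by (intro card_inj_on_le) auto
  then show ?thesis by (simp add: card_Pow card_cartesian_product)
qed

lemma decodableD:
  assumes "decodable n m N G X X'" "(a, b) \<in> G" "(a', b') \<in> G"
    and "\<forall>k<N. \<forall>i<max n m. rx n m X X' a b k i = rx n m X X' a' b' k i"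
  shows "a = a'"
  using assms(1)[unfolded decodable_def same_def, THEN bspec, OF assms(2), unfolded prod.case,
      THEN bspec, OF assms(3), unfolded prod.case] assms(4) by (rule mp)

lemma causalD:
  assumes "causal n m Fo Fc N UNIV UNIV X X'"
    and "Fo = 1 \<Longrightarrow> \<forall>k'<k. \<forall>i<max n m. rx n m X X' a b k' i = rx n m X X' a b' k' i"
    and "Fc = 1 \<Longrightarrow> \<forall>k'<k. \<forall>i<max n m. rx n m X' X b a k' i = rx n m X' X b' a k' i"
    and "k < N" "i < max n m"
  shows "X a b k i = X a b' k i"
proof -
  note step = assms(1)[unfolded causal_def same_def, THEN bspec, OF UNIV_I, THEN bspec, OF UNIV_I,
      THEN bspec, OF UNIV_I, THEN spec, THEN mp, OF assms(4)]
  show ?thesis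
  proof (rule step[THEN mp, THEN mp, THEN spec, THEN mp])
    show "Fo = 1 \<longrightarrow> (\<forall>k'<k. \<forall>i<max n m. rx n m X X' a b k' i = rx n m X X' a b' k' i)"
      by (intro impI assms(2))
    show "Fc = 1 \<longrightarrow> (\<forall>k'<k. \<forall>i<max n m. rx n m X' X b a k' i = rx n m X' X b' a k' i)"
      by (intro impI assms(3))
  qed (rule assms(5))
qed

text \<open>The shifts push all levels of the own signal from \<open>n\<close> on, and of the other
  one from \<open>m\<close> on, out of the received vector.\<close>

lemma chan_cong:
  assumes "\<And>i. i < n \<Longrightarrow> x i = y i" "\<And>i. i < m \<Longrightarrow> x' i = y' i" "i < max n m"
  shows "chan n m x x' i = chan n m y y' i"
  using assms by (auto simp: chan_def sh_def max_def split: if_splits)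

text \<open>Subtracting the known own signal from the output uncovers the top \<open>m\<close>
  levels of the interferer.\<close>

lemma chan_cross_eq:
  assumes "\<And>i. i < n \<Longrightarrow> x i = y i" "\<forall>i<max n m. chan n m x x' i = chan n m y y' i" "i < m"
  shows "x' i = y' i"
proof (cases "n \<le> m")
  case True
  have "m - n \<le> i \<Longrightarrow> x (i - (m - n)) = y (i - (m - n))"
    using assms(1)[of "i - (m - n)"] assms(3) True by simp
  moreover have "chan n m x x' i = chan n m y y' i" using assms(2,3) by simp
  ultimately show ?thesis using True by (simp add: chan_strong split: if_splits)
next
  case False
  then have le: "m \<le> n" by simp
  define d where "d = n - m"
  have "i + d < n" using assms(3) le by (simp add: d_def)
  then have "x (i + d) = y (i + d)" "chan n m x x' (i + d) = chan n m y y' (i + d)"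
    using assms(1,2) by simp_all
  then show ?thesis by (simp add: chan_weak[OF le] flip: d_def)
qed

lemma cutset_count:
  assumes "decodable n m N G X X'"
  shows "card {a. (a, b) \<in> G} \<le> 2 ^ (N * max n m)"
  by (rule card_le_bits[where \<phi> = "\<lambda>a. rx n m X X' a b"]) (use decodableD[OF assms] in blast)

text \<open>Fix \<open>b\<close>. Transmitter 2 then learns about \<open>a\<close> at most through
  the first output. Hence, by induction on time, past first outputs fix \<open>X'\<close>, and with
  the top \<open>n\<close> levels of \<open>X\<close> they fix the next first output, from which
  \<open>a\<close> is decoded.\<close>

lemma direct_link_count:
  assumes "causal n m F22 F12 N UNIV UNIV X' X" "F22 \<noteq> 1" "decodable n m N G X X'"
  shows "card {a. (a, b) \<in> G} \<le> 2 ^ (N * n)"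
proof (rule card_le_bits[where \<phi> = "\<lambda>a. X a b"])
  fix a a'
  assume G: "a \<in> {a. (a, b) \<in> G}" "a' \<in> {a. (a, b) \<in> G}" and x: "\<forall>k<N. \<forall>i<n. X a b k i = X a' b k i"
  have "\<forall>i<max n m. rx n m X X' a b k i = rx n m X X' a' b k i" if "k < N" for k
    using that
  proof (induction k rule: less_induct)
    case (less k)
    then have IH: "\<forall>k'<k. \<forall>i<max n m. rx n m X X' a b k' i = rx n m X X' a' b k' i"
      by (meson less_trans)
    have "X' b a k i = X' b a' k i" if "i < max n m" for i
      by (rule causalD[OF assms(1)]) (use assms(2) IH less(2) that in simp_all)
    then show ?case
      unfolding rx_def by (intro allI impI chan_cong) (use x less(2) in simp_all)
  qed
  then show "a = a'" using decodableD[OF assms(3), of a b a' b] G by simp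
qed

text \<open>The first output determines the first message, hence the top levels of the second signal; then
  its remaining levels give the second output.\<close>

lemma sum_count:
  assumes "causal n m F11 F21 N UNIV UNIV X X'"
    and "decodable n m N G X X'" "decodable n m N (G\<inverse>) X' X"
  shows "card G \<le> 2 ^ (N * (max n m + (n - m)))"
proof (rule card_le_bits[where \<phi> = "\<lambda>(a, b) k i.
    if i < max n m then rx n m X X' a b k i else X' b a k (m + (i - max n m))"])
  fix s s'
  assume G: "s \<in> G" "s' \<in> G" and bits: "\<forall>k<N. \<forall>i<max n m + (n - m).
      (case s of (a, b) \<Rightarrow> \<lambda>k i. if i < max n m then rx n m X X' a b k i else X' b a k (m + (i - max n m))) k i =
      (case s' of (a, b) \<Rightarrow> \<lambda>k i. if i < max n m then rx n m X X' a b k i else X' b a k (m + (i - max n m))) k i"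
  obtain a b a' b' where s: "s = (a, b)" "s' = (a', b')" by (metis surj_pair)
  have y: "\<forall>i<max n m. rx n m X X' a b k i = rx n m X X' a' b' k i" if "k < N" for k
    using bits that by (simp add: s) (metis trans_less_add1)
  have low: "X' b a k (m + i) = X' b' a' k (m + i)" if "k < N" "i < n - m" for k i
    using bits[rule_format, of k "max n m + i"] that by (simp add: s)
  have a: "a' = a" using decodableD[OF assms(2), of a b a' b'] y G by (simp add: s)
  \<comment> \<open>Induction on time: whatever links exist, the past of both outputs fixes
    \<open>X\<close>; subtracting it from the first output gives the top levels of
    \<open>X'\<close>, and the recorded levels complete it.\<close>
  have "\<forall>i<max n m. rx n m X' X b a k i = rx n m X' X b' a k i" if "k < N" for k
    using that
  proof (induction k rule: less_induct)
    case (less k)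
    then have IH: "\<forall>k'<k. \<forall>i<max n m. rx n m X' X b a k' i = rx n m X' X b' a k' i"
      by (meson less_trans)
    have prev: "\<forall>k'<k. \<forall>i<max n m. rx n m X X' a b k' i = rx n m X X' a b' k' i"
      using y less(2) unfolding a by (meson less_trans)
    have x: "X a b k i = X a b' k i" if "i < max n m" for i
      by (rule causalD[OF assms(1) prev IH less(2) that])
    have top: "X' b a k i = X' b' a k i" if "i < m" for i
    proof (rule chan_cross_eq[OF _ _ that])
      show "\<forall>i<max n m. chan n m (X a b k) (X' b a k) i = chan n m (X a b' k) (X' b' a k) i"
        using y[OF less(2)] by (simp add: rx_def a)
    qed (use x in simp)
    have "X' b a k i = X' b' a k i" if "i < n" for i
    proof (cases "i < m")
      case False
      then show ?thesis using low[OF less(2), of "i - m"] that a by simp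
    qed (rule top)
    then show ?case
      unfolding rx_def by (intro allI impI chan_cong) (use x in simp_all)
  qed
  then have "b = b'" using decodableD[OF assms(3), of b a b' a] G a by (simp add: s)
  with a show "s = s'" by (simp add: s)
qed

text \<open>Three messages \<open>a\<close>, \<open>a'\<close>, \<open>b\<close> such that both \<open>(a, b)\<close> and \<open>(a', b)\<close> are decoded correctly are
  recovered in turn: the first output on \<open>(a, b)\<close> gives \<open>a\<close> and the top levels of the second signal, with
  which the second output on \<open>(a', b)\<close> gives \<open>b\<close> and the top levels of the first signal, whose
  remaining levels then give \<open>a'\<close>.\<close>

lemma triple_count:
  assumes "causal n m 1 0 N UNIV UNIV X X'" "causal n m 0 0 N UNIV UNIV X' X"
    and "decodable n m N G X X'" "decodable n m N (G\<inverse>) X' X"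
  shows "card {(a, a', b). (a, b) \<in> G \<and> (a', b) \<in> G} \<le> 2 ^ (N * (max n m + (n - m) + max (n - m) m))"
proof -
  define q where "q = max n m"
  define r where "r = n - m"
  \<comment> \<open>Of the second output on \<open>(a', b)\<close> only the lowest \<open>L\<close>
    levels are recorded; the levels above them can be recovered from the first output on
    \<open>(a, b)\<close>.\<close>
  define L where "L = max r m"
  define \<phi> where "\<phi> = (\<lambda>(a, a', b) k i.
    if i < q then rx n m X X' a b k i
    else if i < q + r then X a' b k (m + (i - q))
    else rx n m X' X b a' k (q - L + (i - q - r)))"
  show ?thesis unfolding r_def[symmetric] unfolding q_def[symmetric] L_def[symmetric]
  proof (rule card_le_bits[where \<phi> = \<phi>])
    fix s s'
    assume G: "s \<in> {(a, a', b). (a, b) \<in> G \<and> (a', b) \<in> G}" "s' \<in> {(a, a', b). (a, b) \<in> G \<and> (a', b) \<in> G}"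
      and bits: "\<forall>k<N. \<forall>i<q + r + L. \<phi> s k i = \<phi> s' k i"
    obtain a a' b c c' e where s: "s = (a, a', b)" "s' = (c, c', e)" by (metis prod_cases3)
    have G: "(a, b) \<in> G" "(a', b) \<in> G" "(c, e) \<in> G" "(c', e) \<in> G" using G by (simp_all add: s)
    have y: "rx n m X X' a b k i = rx n m X X' c e k i" if "k < N" "i < q" for k i
      using bits[rule_format, of k i] that by (simp add: s \<phi>_def)
    have low: "X a' b k (m + i) = X c' e k (m + i)" if "k < N" "i < r" for k i
      using bits[rule_format, of k "q + i"] that by (simp add: s \<phi>_def)
    have y': "rx n m X' X b a' k (q - L + i) = rx n m X' X e c' k (q - L + i)" if "k < N" "i < L" for k i
      using bits[rule_format, of k "q + r + i"] that by (simp add: s \<phi>_def)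
    have c: "c = a" using decodableD[OF assms(3) G(1,3)] y by (simp add: q_def)
    have X'_own: "X' v u k i = X' v u' k i" if "k < N" "i < q" for v u u' k i
      by (rule causalD[OF assms(2)]) (use that in \<open>simp_all add: q_def\<close>)
    have top: "X' b u k i = X' e u' k i" if "k < N" "i < m" for u u' k i
    proof -
      have prev: "\<forall>k'<k. \<forall>i<max n m. rx n m X X' a b k' i = rx n m X X' a e k' i"
        using y that(1) unfolding c q_def by (meson less_trans)
      have "X a b k i = X a e k i" if "i < q" for i
        by (rule causalD[OF assms(1) prev _ \<open>k < N\<close>]) (use that in \<open>simp_all add: q_def\<close>)
      moreover have "\<forall>i<max n m. chan n m (X a b k) (X' b a k) i = chan n m (X a e k) (X' e a k) i"
        using y[OF that(1)] unfolding c rx_def q_def by simp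
      ultimately have "X' b a k i = X' e a k i"
        by (rule chan_cross_eq[of n "X a b k" "X a e k" m, OF _ _ that(2)]) (simp_all add: q_def)
      then show ?thesis
        using X'_own[of k i b u a] X'_own[of k i e u' a] that by (simp add: q_def)
    qed
    have y'_all: "rx n m X' X b a' k i = rx n m X' X e c' k i" if "k < N" "i < q" for k i
    proof (cases "q - L \<le> i")
      case True
      then show ?thesis using y'[OF that(1), of "i - (q - L)"] that by simp
    next
      \<comment> \<open>Such a level lies in the clean part of receiver 2 and shows one of the top
        \<open>m\<close> levels of \<open>X'\<close>, fixed by \<open>top\<close>.\<close>
      case False
      then have "m \<le> n" "i < m" "i < r"
        using that(2) by (simp_all add: q_def L_def r_def max_def split: if_splits)
      then show ?thesis using top[OF that(1), of i] by (simp add: rx_def chan_weak flip: r_def)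
    qed
    have b: "e = b" using decodableD[OF assms(4), of b a' e c'] G y'_all by (simp add: q_def)
    have "X a' b k i = X c' b k i" if "k < N" "i < n" for k i
    proof (cases "i < m")
      case True
      have "\<forall>i<max n m. chan n m (X' b a' k) (X a' b k) i = chan n m (X' b c' k) (X c' b k) i"
        using y'_all[OF that(1)] unfolding b rx_def q_def by simp
      then show ?thesis
        by (rule chan_cross_eq[of n "X' b a' k" "X' b c' k" m, rotated])
          (use True X'_own[OF that(1), of _ b a' c'] in \<open>simp_all add: q_def\<close>)
    next
      case False
      then show ?thesis using low[OF that(1), of "i - m"] that b by (simp add: r_def)
    qed
    then have "rx n m X X' a' b k i = rx n m X X' c' b k i" if "k < N" "i < q" for k i
      unfolding rx_def using that X'_own[OF that(1), of _ b a' c']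
      by (intro chan_cong) (simp_all add: q_def)
    then have "a' = c'" using decodableD[OF assms(3), of a' b c' b] G b by (simp add: q_def)
    then show "s = s'" using b c by (simp add: s)
  qed
qed

section \<open>Reliable codes\<close>

definition partial_code ::
  "nat \<Rightarrow> nat \<Rightarrow> feedback_model \<Rightarrow> nat \<Rightarrow> real \<Rightarrow> nat set \<Rightarrow> nat set \<Rightarrow>
     (nat, nat) signal \<Rightarrow> (nat, nat) signal \<Rightarrow> (nat \<times> nat) set \<Rightarrow> bool"
where
  "partial_code n m F N \<epsilon> A B X X' G \<longleftrightarrow>
     (case F of (F11, F12, F21, F22) \<Rightarrow>
        causal n m F11 F21 N UNIV UNIV X X' \<and> causal n m F22 F12 N UNIV UNIV X' X) \<and>
     decodable n m N G X X' \<and> decodable n m N (G\<inverse>) X' X \<and>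
     G \<subseteq> A \<times> B \<and> (1 - \<epsilon>) * (real (card A) * real (card B)) \<le> real (card G)"

lemma partial_code_swap:
  assumes "partial_code n m (F11, F12, F21, F22) N \<epsilon> A B X X' G"
  shows "partial_code n m (F22, F21, F12, F11) N \<epsilon> B A X' X (G\<inverse>)"
proof -
  have "G\<inverse> \<subseteq> B \<times> A" using assms by (auto simp: partial_code_def)
  with assms show ?thesis
    by (simp add: partial_code_def mult.commute[of "real (card B)"])
qed

text \<open>What the counting needs of \<open>achievable\<close>, in a form symmetric in the users,
  so that bounds on the second rate follow by \<open>reliable_swap\<close>.\<close>

definition reliable :: "nat \<Rightarrow> nat \<Rightarrow> feedback_model \<Rightarrow> real \<Rightarrow> real \<Rightarrow> bool" where
  "reliable n m F R1 R2 \<longleftrightarrow> 0 \<le> R1 \<and> 0 \<le> R2 \<and> (\<forall>\<epsilon>>0. eventually (\<lambda>N.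
     \<exists>X X' G. partial_code n m F N \<epsilon> (messages N R1) (messages N R2) X X' G) sequentially)"

lemma reliable_swap:
  assumes "reliable n m (F11, F12, F21, F22) R1 R2"
  shows "reliable n m (F22, F21, F12, F11) R2 R1"
  unfolding reliable_def
proof (intro conjI allI impI)
  fix \<epsilon> :: real
  assume "0 < \<epsilon>"
  then have "eventually (\<lambda>N. \<exists>X X' G.
      partial_code n m (F11, F12, F21, F22) N \<epsilon> (messages N R1) (messages N R2) X X' G) sequentially"
    using assms by (simp add: reliable_def)
  then show "eventually (\<lambda>N. \<exists>X X' G.
      partial_code n m (F22, F21, F12, F11) N \<epsilon> (messages N R2) (messages N R1) X X' G) sequentially"
    by eventually_elim (use partial_code_swap in blast)
qed (use assms in \<open>simp_all add: reliable_def\<close>)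

text \<open>The signals record what the encoders send on each message pair, and \<open>G\<close>
  removes both error events. For large \<open>N\<close> each event has less than a share of
  \<open>\<epsilon> / 2\<close> of the pairs, so the union bound gives the size of
  \<open>G\<close>.\<close>

lemma achievable_imp_reliable:
  assumes "achievable n m F R1 R2"
  shows "reliable n m F R1 R2"
proof -
  let ?q = "max n m"
  obtain F11 F12 F21 F22 where F: "F = (F11, F12, F21, F22)" by (metis prod_cases4)
  obtain f1 f2 :: "nat \<Rightarrow> encoder" and h1 h2 :: "nat \<Rightarrow> decoder" where R: "0 \<le> R1" "0 \<le> R2"
    and enc: "\<forall>N. is_encoder ?q (f1 N) \<and> is_encoder ?q (f2 N)"
    and err1: "(\<lambda>N. measure_pmf.prob (message_pmf N R1 R2)
           {(w1, w2). h1 N (fst (outputs n m F (f1 N) (f2 N) w1 w2 N)) \<noteq> w1}) \<longlonglongrightarrow> 0"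
    and err2: "(\<lambda>N. measure_pmf.prob (message_pmf N R1 R2)
           {(w1, w2). h2 N (snd (outputs n m F (f1 N) (f2 N) w1 w2 N)) \<noteq> w2}) \<longlonglongrightarrow> 0"
    using assms unfolding achievable_def by (elim exE conjE)
  show ?thesis
    unfolding reliable_def
  proof (intro conjI R allI impI)
    fix \<epsilon> :: real
    assume "0 < \<epsilon>"
    then have "0 < \<epsilon> / 2" by simp
    from order_tendstoD(2)[OF err1 this] order_tendstoD(2)[OF err2 this]
    show "eventually (\<lambda>N. \<exists>X X' G.
        partial_code n m F N \<epsilon> (messages N R1) (messages N R2) X X' G) sequentially"
    proof eventually_elim
      case (elim N)
      define out where "out = outputs n m F (f1 N) (f2 N)"
      define X where "X a b k i = vec_index (f1 N (Suc k) a (feedback F11 (fst (out a b k))) (feedback F21 (snd (out a b k)))) i"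
        for a b k i
      define X' where "X' b a k i = vec_index (f2 N (Suc k) b (feedback F12 (fst (out a b k))) (feedback F22 (snd (out a b k)))) i"
        for a b k i
      have "is_encoder ?q (f1 N)" "is_encoder ?q (f2 N)" by (rule conjunct1[OF spec[OF enc]], rule conjunct2[OF spec[OF enc]])
      then have dim: "dim_vec (f1 N j w ys ys') = ?q" "dim_vec (f2 N j w ys ys') = ?q" for j w ys ys'
        unfolding is_encoder_def by (metis carrier_vecD)+
      have out: "out a b k = (received n m X X' a b k, received n m X' X b a k)" for a b k
      proof (induction k)
        case (Suc k)
        have "f1 N (Suc k) a (feedback F11 (fst (out a b k))) (feedback F21 (snd (out a b k))) = vec ?q (X a b k)"
          "f2 N (Suc k) b (feedback F12 (fst (out a b k))) (feedback F22 (snd (out a b k))) = vec ?q (X' b a k)"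
          by (rule eq_vecI; simp add: X_def X'_def dim)+
        moreover have "chan n m (X a b k) (X' b a k) = rx n m X X' a b k"
          "chan n m (X' b a k) (X a b k) = rx n m X' X b a k" by (simp_all add: rx_def fun_eq_iff)
        ultimately show ?case
          using Suc by (simp add: out_def F Let_def channel_output_vec)
      qed (simp add: out_def)
      have c1: "causal n m F11 F21 N UNIV UNIV X X'"
        unfolding causal_def
      proof (intro ballI allI impI)
        fix a b b' k i
        assume "F11 = 1 \<longrightarrow> same ?q k (rx n m X X' a b) (rx n m X X' a b')"
          "F21 = 1 \<longrightarrow> same ?q k (rx n m X' X b a) (rx n m X' X b' a)"
        then have "feedback F11 (fst (out a b k)) = feedback F11 (fst (out a b' k))"
          "feedback F21 (snd (out a b k)) = feedback F21 (snd (out a b' k))"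
          unfolding out fst_conv snd_conv feedback_map_eq_iff_same by simp_all
        then show "X a b k i = X a b' k i" by (simp add: X_def)
      qed
      have c2: "causal n m F22 F12 N UNIV UNIV X' X"
        unfolding causal_def
      proof (intro ballI allI impI)
        fix b a a' k i
        assume "F22 = 1 \<longrightarrow> same ?q k (rx n m X' X b a) (rx n m X' X b a')"
          "F12 = 1 \<longrightarrow> same ?q k (rx n m X X' a b) (rx n m X X' a' b)"
        then have "feedback F12 (fst (out a b k)) = feedback F12 (fst (out a' b k))"
          "feedback F22 (snd (out a b k)) = feedback F22 (snd (out a' b k))"
          unfolding out fst_conv snd_conv feedback_map_eq_iff_same by simp_all
        then show "X' b a k i = X' b a' k i" by (simp add: X'_def)
      qed
      define S where "S = messages N R1 \<times> messages N R2"
      define E1 where "E1 = {(a, b). h1 N (fst (out a b N)) \<noteq> a}"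
      define E2 where "E2 = {(a, b). h2 N (snd (out a b N)) \<noteq> b}"
      define G where "G = S - E1 - E2"
      have S: "finite S" "S \<noteq> {}" using R by (simp_all add: S_def messages_nonempty)
      have G: "h1 N (received n m X X' a b N) = a" "h2 N (received n m X' X b a N) = b"
        if "(a, b) \<in> G" for a b
        using that by (simp_all add: G_def E1_def E2_def out)
      have d1: "decodable n m N G X X'"
        unfolding decodable_def map_vec_eq_iff_same[symmetric]
      proof (intro ballI case_prodI2 impI)
        fix p p' a b a' b'
        assume "p \<in> G" "p' \<in> G" "p = (a, b)" "p' = (a', b')"
          "received n m X X' a b N = received n m X X' a' b' N"
        then show "a = a'" using G(1)[of a b] G(1)[of a' b'] by (simp del: map_eq_conv)
      qed
      have d2: "decodable n m N (G\<inverse>) X' X"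
        unfolding decodable_def map_vec_eq_iff_same[symmetric]
      proof (intro ballI case_prodI2 impI)
        fix p p' b a b' a'
        assume "p \<in> G\<inverse>" "p' \<in> G\<inverse>" "p = (b, a)" "p' = (b', a')"
          "received n m X' X b a N = received n m X' X b' a' N"
        then show "b = b'" using G(2)[of a b] G(2)[of a' b'] by (simp del: map_eq_conv)
      qed
      have pos: "0 < real (card S)" using S by (simp add: card_gt_0_iff)
      have "real (card (S \<inter> E1)) / real (card S) < \<epsilon> / 2" "real (card (S \<inter> E2)) / real (card S) < \<epsilon> / 2"
        using elim unfolding message_pmf_eq[OF R] S_def[symmetric] out_def[symmetric]
          E1_def[symmetric] E2_def[symmetric] measure_pmf_of_set[OF S(2,1)] by simp_all
      then have "real (card (S \<inter> E1)) < \<epsilon> / 2 * real (card S)" "real (card (S \<inter> E2)) < \<epsilon> / 2 * real (card S)"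
        using pos by (simp_all add: pos_divide_less_eq)
      moreover have "card S \<le> card G + card (S \<inter> E1) + card (S \<inter> E2)"
      proof -
        have "S = G \<union> (S \<inter> E1) \<union> (S \<inter> E2)" by (auto simp: G_def)
        then show ?thesis by (metis (no_types) add_le_mono card_Un_le le_refl le_trans)
      qed
      ultimately have "(1 - \<epsilon>) * real (card S) \<le> real (card G)"
        by (simp add: algebra_simps)
      then have "(1 - \<epsilon>) * (real (card (messages N R1)) * real (card (messages N R2))) \<le> real (card G)"
        by (simp add: S_def card_cartesian_product)
      moreover have "G \<subseteq> messages N R1 \<times> messages N R2" by (auto simp: G_def S_def)
      ultimately have "partial_code n m F N \<epsilon> (messages N R1) (messages N R2) X X' G"
        using c1 c2 d1 d2 by (simp add: partial_code_def F)
      then show ?case by (intro exI)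
    qed
  qed
qed

section \<open>From counts to rates\<close>

text \<open>If \<open>r\<close> exceeded \<open>c\<close>, the quotient of the two exponentials
  would grow beyond any constant \<open>C\<close>.\<close>

lemma rate_le:
  fixes r C :: real and c :: nat
  assumes "eventually (\<lambda>N. 2 powr (real N * r) \<le> C * 2 ^ (N * c)) sequentially"
  shows "r \<le> c"
proof (rule ccontr)
  assume "\<not> r \<le> c"
  then have "0 < r - c" by simp
  then have "filterlim (\<lambda>N. (r - c) * real N) at_top sequentially"
    by (intro filterlim_tendsto_pos_mult_at_top[OF tendsto_const] filterlim_real_sequentially)
  then have "eventually (\<lambda>N. \<bar>C\<bar> + 1 \<le> (r - c) * real N) sequentially"
    by (simp add: filterlim_at_top)
  from eventually_conj[OF assms this] obtain N where
    N: "2 powr (real N * r) \<le> C * 2 ^ (N * c)" "\<bar>C\<bar> + 1 \<le> (r - c) * real N"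
    by (auto simp: eventually_sequentially)
  have "2 powr ((r - c) * real N) = 2 powr (real N * r) / 2 powr real (N * c)"
    by (simp add: algebra_simps flip: powr_diff)
  also have "\<dots> = 2 powr (real N * r) / 2 ^ (N * c)"
    by (simp only: powr_realpow zero_less_numeral)
  also have "\<dots> \<le> C" using N(1) by (simp add: divide_le_eq)
  finally have "2 powr ((r - c) * real N) \<le> C" .
  \<comment> \<open>From exp x \<ge> 1 + x and ln 2 \<ge> 1/2, the right side is at least
    \<bar>C\<bar> + 2.\<close>
  moreover have "C < 2 powr (\<bar>C\<bar> + 1)"
  proof -
    have "\<bar>C\<bar> * (1 / 2) \<le> \<bar>C\<bar> * ln 2" using ln2_ge_two_thirds by (intro mult_left_mono) auto
    then have "1 + \<bar>C\<bar> * (1 / 2) \<le> exp (\<bar>C\<bar> * ln 2)"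
      using exp_ge_add_one_self[of "\<bar>C\<bar> * ln 2"] by linarith
    moreover have "2 powr (\<bar>C\<bar> + 1) = 2 * exp (\<bar>C\<bar> * ln 2)"
      by (simp add: powr_def distrib_right exp_add)
    ultimately show ?thesis by linarith
  qed
  moreover have "2 powr (\<bar>C\<bar> + 1) \<le> 2 powr ((r - c) * real N)" using N(2) by simp
  ultimately show False by linarith
qed

lemma card_le_fibres:
  fixes c :: nat
  assumes "finite A" "finite B" "G \<subseteq> A \<times> B" "\<And>b. card {a. (a, b) \<in> G} \<le> c"
  shows "card G \<le> card B * c"
proof -
  have fin: "finite {a. (a, b) \<in> G}" for b
    by (rule finite_subset[OF _ assms(1)]) (use assms(3) in auto)
  have "G = (SIGMA b:B. {a. (a, b) \<in> G})\<inverse>" using assms(3) by auto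
  then have "card G = card (SIGMA b:B. {a. (a, b) \<in> G})" by (metis card_inverse)
  also have "\<dots> = (\<Sum>b\<in>B. card {a. (a, b) \<in> G})"
    by (rule card_SigmaI) (use assms(2) fin in auto)
  also have "\<dots> \<le> card B * c" using sum_bounded_above[of B "\<lambda>b. card {a. (a, b) \<in> G}" c] assms(4) by simp
  finally show ?thesis .
qed

text \<open>A triple is lost only if \<open>(a, b)\<close> or \<open>(a', b)\<close> lies in the
  complement \<open>D\<close> of \<open>G\<close>. Each case accounts for at most
  \<open>card D * card A\<close> triples, hence the loss \<open>2 * \<epsilon>\<close>.\<close>

lemma card_triples_ge:
  fixes \<epsilon> :: real
  assumes "finite A" "finite B" "G \<subseteq> A \<times> B"
    and "(1 - \<epsilon>) * (real (card A) * real (card B)) \<le> real (card G)"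
  shows "(1 - 2 * \<epsilon>) * (real (card A) * real (card A) * real (card B))
           \<le> real (card {(a, a', b). (a, b) \<in> G \<and> (a', b) \<in> G})"
proof -
  define D where "D = A \<times> B - G"
  define T where "T = {(a, a', b). (a, b) \<in> G \<and> (a', b) \<in> G}"
  have fin: "finite G" "finite D" "finite T"
  proof -
    show "finite G" using assms(1-3) by (meson finite_SigmaI finite_subset)
    show "finite D" using assms by (simp add: D_def)
    have "T \<subseteq> A \<times> A \<times> B" using assms(3) by (auto simp: T_def)
    then show "finite T" using assms(1,2) by (meson finite_SigmaI finite_subset)
  qed
  have "card D = card A * card B - card G"
    using card_Diff_subset[OF fin(1) assms(3)] by (simp add: D_def card_cartesian_product)
  moreover have "card G \<le> card A * card B"
    using card_mono[OF _ assms(3)] assms(1,2) by (simp add: card_cartesian_product)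
  ultimately have D: "real (card D) \<le> \<epsilon> * (real (card A) * real (card B))"
    using assms(4) by (simp add: of_nat_diff algebra_simps)
  let ?f = "\<lambda>((a, b), a'). (a, a', b)" and ?g = "\<lambda>((a', b), a). (a, a', b)"
  have "A \<times> A \<times> B \<subseteq> T \<union> ?f ` (D \<times> A) \<union> ?g ` (D \<times> A)"
  proof
    fix p assume "p \<in> A \<times> A \<times> B"
    then obtain a a' b where p: "p = (a, a', b)" "a \<in> A" "a' \<in> A" "b \<in> B" by (auto elim!: SigmaE)
    consider "(a, b) \<in> D" | "(a', b) \<in> D" | "p \<in> T"
      using p by (auto simp: D_def T_def)
    then show "p \<in> T \<union> ?f ` (D \<times> A) \<union> ?g ` (D \<times> A)"
    proof cases
      case 1
      then have "((a, b), a') \<in> D \<times> A" using p by simp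
      then have "?f ((a, b), a') \<in> ?f ` (D \<times> A)" by (rule imageI)
      then show ?thesis by (simp add: p)
    next
      case 2
      then have "((a', b), a) \<in> D \<times> A" using p by simp
      then have "?g ((a', b), a) \<in> ?g ` (D \<times> A)" by (rule imageI)
      then show ?thesis by (simp add: p)
    qed simp
  qed
  then have "card (A \<times> A \<times> B) \<le> card (T \<union> ?f ` (D \<times> A) \<union> ?g ` (D \<times> A))"
    using fin assms(1) by (intro card_mono) simp_all
  also have "\<dots> \<le> card T + card (?f ` (D \<times> A)) + card (?g ` (D \<times> A))"
    using card_Un_le[of "T \<union> ?f ` (D \<times> A)" "?g ` (D \<times> A)"] card_Un_le[of T "?f ` (D \<times> A)"] by linarith
  also have "\<dots> \<le> card T + card D * card A + card D * card A"
    using card_image_le[of "D \<times> A" ?f] card_image_le[of "D \<times> A" ?g] fin assms(1)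
    by (simp add: card_cartesian_product)
  finally have "card A * (card A * card B) \<le> card T + card D * card A + card D * card A"
    by (simp add: card_cartesian_product)
  then have "real (card A) * (real (card A) * real (card B)) \<le> real (card T) + 2 * (real (card D) * real (card A))"
    by (simp flip: of_nat_mult of_nat_add)
  moreover have "real (card D) * real (card A) \<le> \<epsilon> * (real (card A) * real (card B)) * real (card A)"
    using D by (intro mult_right_mono) auto
  ultimately show ?thesis by (simp add: T_def algebra_simps)
qed

lemma reliable_bound:
  fixes c :: nat
  assumes "reliable n m F R1 R2" "0 < \<epsilon>"
    and "\<And>N X X' G. partial_code n m F N \<epsilon> (messages N R1) (messages N R2) X X' G \<Longrightarrow>
           2 powr (real N * r) \<le> C * 2 ^ (N * c)"
  shows "r \<le> real c"
proof (rule rate_le)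
  have "eventually (\<lambda>N. \<exists>X X' G. partial_code n m F N \<epsilon> (messages N R1) (messages N R2) X X' G) sequentially"
    using assms(1,2) by (simp add: reliable_def)
  then show "eventually (\<lambda>N. 2 powr (real N * r) \<le> C * 2 ^ (N * c)) sequentially"
    by eventually_elim (elim exE, rule assms(3))
qed

lemma reliable_rate1:
  assumes "reliable n m F R1 R2"
    and "\<And>N X X' G b. partial_code n m F N (1 / 2) (messages N R1) (messages N R2) X X' G \<Longrightarrow>
           card {a. (a, b) \<in> G} \<le> 2 ^ (N * c)"
  shows "R1 \<le> real c"
\<comment> \<open>4 = 2 for the half of the pairs that is kept, times 2 for rounding
  \<open>card ?A\<close>.\<close>
proof (rule reliable_bound[OF assms(1), of "1 / 2" _ 4])
  fix N X X' G
  assume pc: "partial_code n m F N (1 / 2) (messages N R1) (messages N R2) X X' G"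
  have R: "0 \<le> R1" "0 \<le> R2" using assms(1) by (simp_all add: reliable_def)
  let ?A = "messages N R1" and ?B = "messages N R2"
  have le: "card G \<le> card ?B * 2 ^ (N * c)"
    by (rule card_le_fibres[where A = ?A, OF finite_messages finite_messages _ assms(2)[OF pc]])
      (use pc in \<open>simp add: partial_code_def\<close>)
  have "real (card G) \<le> real (card ?B) * 2 ^ (N * c)"
    using of_nat_mono[OF le, where 'a = real] by simp
  moreover have "1 / 2 * (real (card ?A) * real (card ?B)) \<le> real (card G)"
    using pc by (simp add: partial_code_def)
  ultimately have "real (card ?A) * real (card ?B) \<le> 2 * (real (card ?B) * 2 ^ (N * c))"
    by linarith
  then have "real (card ?B) * real (card ?A) \<le> real (card ?B) * (2 * 2 ^ (N * c))"
    by (simp add: ac_simps)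
  moreover have "0 < real (card ?B)" using R by (simp add: card_gt_0_iff messages_nonempty)
  ultimately have "real (card ?A) \<le> 2 * 2 ^ (N * c)" by (simp only: mult_le_cancel_left_pos)
  then show "2 powr (real N * R1) \<le> 4 * 2 ^ (N * c)"
    using card_messages_ge[OF R(1), of N] by linarith
qed simp

lemma reliable_cutset:
  assumes "reliable n m F R1 R2"
  shows "R1 \<le> real (max n m)"
proof (rule reliable_rate1[OF assms])
  fix N X X' G b
  assume "partial_code n m F N (1 / 2) (messages N R1) (messages N R2) X X' G"
  then show "card {a. (a, b) \<in> G} \<le> 2 ^ (N * max n m)"
    by (intro cutset_count[of n m N G X X']) (simp add: partial_code_def)
qed

lemma reliable_direct_link:
  assumes "reliable n m (F11, F12, F21, F22) R1 R2" "F22 \<noteq> 1"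
  shows "R1 \<le> real n"
proof (rule reliable_rate1[OF assms(1)])
  fix N X X' G b
  assume "partial_code n m (F11, F12, F21, F22) N (1 / 2) (messages N R1) (messages N R2) X X' G"
  then show "card {a. (a, b) \<in> G} \<le> 2 ^ (N * n)"
    by (intro direct_link_count[of n m F22 F12 N X' X G, OF _ assms(2)]) (simp_all add: partial_code_def)
qed

lemma reliable_sum:
  assumes "reliable n m F R1 R2"
  shows "R1 + R2 \<le> real (max n m + (n - m))"
\<comment> \<open>8 = 2 for the half of the pairs that is kept, times 2 for rounding each of the two
  message numbers.\<close>
proof (rule reliable_bound[OF assms(1), of "1 / 2" _ 8])
  fix N X X' G
  assume pc: "partial_code n m F N (1 / 2) (messages N R1) (messages N R2) X X' G"
  have R: "0 \<le> R1" "0 \<le> R2" using assms(1) by (simp_all add: reliable_def)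
  let ?A = "messages N R1" and ?B = "messages N R2"
  obtain F11 F12 F21 F22 where F: "F = (F11, F12, F21, F22)" by (metis prod_cases4)
  have le: "card G \<le> 2 ^ (N * (max n m + (n - m)))"
    by (rule sum_count[of n m F11 F21 N X X']) (use pc in \<open>simp_all add: partial_code_def F\<close>)
  have "real (card G) \<le> 2 ^ (N * (max n m + (n - m)))"
    using of_nat_mono[OF le, where 'a = real] by simp
  moreover have "1 / 2 * (real (card ?A) * real (card ?B)) \<le> real (card G)"
    using pc by (simp add: partial_code_def)
  moreover have "2 powr (real N * R1) * 2 powr (real N * R2) \<le> (2 * real (card ?A)) * (2 * real (card ?B))"
    using R by (intro mult_mono card_messages_ge) auto
  moreover have "2 powr (real N * (R1 + R2)) = 2 powr (real N * R1) * 2 powr (real N * R2)"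
    by (simp add: distrib_left powr_add)
  ultimately show "2 powr (real N * (R1 + R2)) \<le> 8 * 2 ^ (N * (max n m + (n - m)))"
    by linarith
qed simp

lemma reliable_two_one:
  assumes "reliable n m (1, 0, 0, 0) R1 R2"
  shows "2 * R1 + R2 \<le> real (max n m + (n - m) + max (n - m) m)"
\<comment> \<open>With \<open>\<epsilon> = 1 / 4\<close> at least half of the triples survive; each
  of the three messages in a triple adds a rounding factor 2.\<close>
proof (rule reliable_bound[OF assms(1), of "1 / 4" _ 16])
  fix N X X' G
  assume pc: "partial_code n m (1, 0, 0, 0) N (1 / 4) (messages N R1) (messages N R2) X X' G"
  have R: "0 \<le> R1" "0 \<le> R2" using assms(1) by (simp_all add: reliable_def)
  let ?A = "messages N R1" and ?B = "messages N R2"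
  let ?T = "{(a, a', b). (a, b) \<in> G \<and> (a', b) \<in> G}"
  have le: "card ?T \<le> 2 ^ (N * (max n m + (n - m) + max (n - m) m))"
    by (rule triple_count[of n m N X X']) (use pc in \<open>simp_all add: partial_code_def\<close>)
  have "real (card ?T) \<le> 2 ^ (N * (max n m + (n - m) + max (n - m) m))"
    using of_nat_mono[OF le, where 'a = real] by simp
  moreover have "real (card ?A) * real (card ?A) * real (card ?B) \<le> 2 * real (card ?T)"
    using card_triples_ge[of ?A ?B G "1 / 4"] pc by (simp add: partial_code_def)
  moreover have "2 powr (real N * R1) * 2 powr (real N * R1) * 2 powr (real N * R2)
      \<le> 8 * (real (card ?A) * real (card ?A) * real (card ?B))"
  proof -
    have "2 powr (real N * R1) * 2 powr (real N * R1) * 2 powr (real N * R2)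
        \<le> (2 * real (card ?A)) * (2 * real (card ?A)) * (2 * real (card ?B))"
      using R by (intro mult_mono card_messages_ge) auto
    then show ?thesis by simp
  qed
  moreover have "2 powr (real N * (2 * R1 + R2)) = 2 powr (real N * R1) * 2 powr (real N * R1) * 2 powr (real N * R2)"
    by (simp flip: powr_add) (simp add: algebra_simps)
  ultimately show "2 powr (real N * (2 * R1 + R2)) \<le> 16 * 2 ^ (N * (max n m + (n - m) + max (n - m) m))"
    by linarith
qed simp

section \<open>Outer bounds for the capacity region\<close>

text \<open>A half-plane is closed, so a linear bound on reliable pairs passes to the
  closure.\<close>

lemma capacity_region_le:
  fixes u v w :: real
  assumes "\<And>R1 R2. reliable n m F R1 R2 \<Longrightarrow> u * R1 + v * R2 \<le> w"
    and "(R1, R2) \<in> capacity_region n m F"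
  shows "u * R1 + v * R2 \<le> w"
proof -
  have "closed {p :: real \<times> real. u * fst p + v * snd p \<le> w}"
    by (intro closed_Collect_le continuous_intros)
  moreover have "{(R1, R2). achievable n m F R1 R2} \<subseteq> {p. u * fst p + v * snd p \<le> w}"
    using assms(1)[OF achievable_imp_reliable] by auto
  ultimately have "capacity_region n m F \<subseteq> {p. u * fst p + v * snd p \<le> w}"
    unfolding capacity_region_def by (rule closure_minimal[rotated])
  with assms(2) show ?thesis by auto
qed

lemma capacity_region_nonneg:
  assumes "(R1, R2) \<in> capacity_region n m F"
  shows "0 \<le> R1" "0 \<le> R2"
proof -
  have "- 1 * R1 + 0 * R2 \<le> 0"
    by (rule capacity_region_le[OF _ assms]) (simp add: reliable_def)
  moreover have "0 * R1 + - 1 * R2 \<le> 0"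
    by (rule capacity_region_le[OF _ assms]) (simp add: reliable_def)
  ultimately show "0 \<le> R1" "0 \<le> R2" by simp_all
qed

lemma capacity_region_rate1:
  fixes c :: real
  assumes "(R1, R2) \<in> capacity_region n m F" "\<And>R1 R2. reliable n m F R1 R2 \<Longrightarrow> R1 \<le> c"
  shows "R1 \<le> c"
proof -
  have "1 * R1 + 0 * R2 \<le> c"
    by (rule capacity_region_le[OF _ assms(1)]) (simp add: assms(2))
  then show ?thesis by simp
qed

lemma capacity_region_rate2:
  fixes c :: real
  assumes "(R1, R2) \<in> capacity_region n m (F11, F12, F21, F22)"
    and "\<And>R1 R2. reliable n m (F22, F21, F12, F11) R2 R1 \<Longrightarrow> R2 \<le> c"
  shows "R2 \<le> c"
proof -
  have "0 * R1 + 1 * R2 \<le> c"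
    by (rule capacity_region_le[OF _ assms(1)]) (simp add: assms(2)[OF reliable_swap])
  then show ?thesis by simp
qed

lemma capacity_region_cutset:
  assumes "(R1, R2) \<in> capacity_region n m (F11, F12, F21, F22)"
  shows "R1 \<le> max (real n) (real m)" "R2 \<le> max (real n) (real m)"
  using capacity_region_rate1[OF assms reliable_cutset] capacity_region_rate2[OF assms reliable_cutset]
  by (simp_all add: of_nat_max)

lemma capacity_region_sum:
  assumes "(R1, R2) \<in> capacity_region n m F"
  shows "R1 + R2 \<le> pos_part (real n - real m) + max (real n) (real m)"
proof -
  have "1 * R1 + 1 * R2 \<le> real (max n m + (n - m))"
    by (rule capacity_region_le[OF _ assms]) (simp only: mult_1 reliable_sum)
  moreover have "real (max n m + (n - m)) = pos_part (real n - real m) + max (real n) (real m)"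
    by (cases "m \<le> n") (simp_all add: pos_part_def max_def of_nat_diff)
  ultimately show ?thesis by simp
qed

lemma capacity_region_two_one:
  assumes "(R1, R2) \<in> capacity_region n m (1, 0, 0, 0)"
  shows "2 * R1 + R2 \<le> pos_part (real n - real m) + max (real n) (real m) + max (real n - real m) (real m)"
proof -
  have "2 * R1 + 1 * R2 \<le> real (max n m + (n - m) + max (n - m) m)"
    by (rule capacity_region_le[OF _ assms]) (simp only: mult_1 reliable_two_one)
  moreover have "real (max n m + (n - m) + max (n - m) m) =
      pos_part (real n - real m) + max (real n) (real m) + max (real n - real m) (real m)"
    by (cases "m \<le> n") (simp_all add: pos_part_def of_nat_max of_nat_diff)
  ultimately show ?thesis by simp
qed

section \<open>The four shapes of the region\<close>

text \<open>The two corners differ by \<open>m\<close> in each coordinate, so the line through them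
  is the sum bound multiplied by \<open>m\<close>.\<close>

lemma capacity_region_weak:
  assumes "m \<le> n" "corner n m F n (n - m)" "corner n m F (n - m) n"
    and "0 \<le> R1" "0 \<le> R2" "R1 \<le> real n" "R2 \<le> real n" "R1 + R2 \<le> 2 * real n - real m"
  shows "(R1, R2) \<in> capacity_region n m F"
proof (rule capacity_region_segment[OF assms(2,3,4,5)])
  have "real m * (R1 + R2) \<le> real m * (2 * real n - real m)"
    using assms(8) by (intro mult_left_mono) auto
  then show "(real n - real (n - m)) * R1 + (real n - real (n - m)) * R2
      \<le> (real n - real (n - m)) * real n + (real n - real (n - m)) * real (n - m)"
    using assms(1) by (simp add: algebra_simps)
qed (use assms in auto)

lemma pair_set_eqI: "(\<And>x y. (x, y) \<in> A \<longleftrightarrow> P x y) \<Longrightarrow> A = {(x, y). P x y}"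
  by auto

text \<open>For \<open>m \<le> n\<close> either transmitter can relay. For \<open>n < m\<close> the
  region is a triangle, whose corners \<open>(m, 0)\<close> and \<open>(0, m)\<close> arise when one
  user only relays for the other.\<close>

lemma capacity_region_both:
  "capacity_region n m (1, F12, F21, 1) =
     {(R1, R2). 0 \<le> R1 \<and> 0 \<le> R2 \<and>
        R1 \<le> max (real n) (real m) \<and> R2 \<le> max (real n) (real m) \<and>
        R1 + R2 \<le> pos_part (real n - real m) + max (real n) (real m)}"
proof (rule pair_set_eqI, rule iffI)
  fix R1 R2 :: real
  assume "0 \<le> R1 \<and>
    0 \<le> R2 \<and>
    R1 \<le> max (real n) (real m) \<and>
    R2 \<le> max (real n) (real m) \<and>
    R1 + R2 \<le> pos_part (real n - real m) + max (real n) (real m)"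
  then have R: "0 \<le> R1" "0 \<le> R2" "R1 \<le> max (real n) (real m)" "R2 \<le> max (real n) (real m)"
    "R1 + R2 \<le> pos_part (real n - real m) + max (real n) (real m)"
    by simp_all
  show "(R1, R2) \<in> capacity_region n m (1, F12, F21, 1)"
  proof (cases "m \<le> n")
    case True
    then show ?thesis
      using R by (intro capacity_region_weak corner_relay corner_swap[OF corner_relay]) (auto simp: pos_part_def)
  next
    case False
    then have le: "n \<le> m" by simp
    show ?thesis
    proof (rule capacity_region_segment[OF corner_swap[OF corner_relay_all[OF le]] corner_relay_all[OF le] R(1,2)])
      have "real m * (R1 + R2) \<le> real m * real m"
        using R(5) le by (intro mult_left_mono) (auto simp: pos_part_def)
      then show "(real m - real 0) * R1 + (real m - real 0) * R2 \<le> (real m - real 0) * real m + (real m - real 0) * real 0"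
        by (simp add: algebra_simps)
    qed (use R le in auto)
  qed
next
  fix R1 R2
  assume R: "(R1, R2) \<in> capacity_region n m (1, F12, F21, 1)"
  show "0 \<le> R1 \<and> 0 \<le> R2 \<and> R1 \<le> max (real n) (real m) \<and> R2 \<le> max (real n) (real m) \<and>
        R1 + R2 \<le> pos_part (real n - real m) + max (real n) (real m)"
    using capacity_region_nonneg[OF R] capacity_region_cutset[OF R] capacity_region_sum[OF R] by simp
qed

text \<open>The corners \<open>(n, m - n)\<close> and \<open>(0, m)\<close> lie on the line of the
  sum bound, here multiplied by \<open>n\<close>.\<close>

lemma capacity_region_strong_fb:
  assumes "n \<le> m" "0 \<le> R1" "0 \<le> R2" "R1 \<le> real n" "R2 \<le> real m" "R1 + R2 \<le> real m"
  shows "(R1, R2) \<in> capacity_region n m (1, F12, F21, F22)"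
proof (rule capacity_region_segment[OF corner_forward corner_relay_all])
  have "real n * (R1 + R2) \<le> real n * real m"
    using assms by (intro mult_left_mono) auto
  then show "(real m - real (m - n)) * R1 + (real n - real 0) * R2
      \<le> (real m - real (m - n)) * real n + (real n - real 0) * real (m - n)"
    using assms(1) by (simp add: algebra_simps)
qed (use assms in auto)

lemma capacity_region_own:
  assumes "F12 = 1 \<or> F21 = 1"
  shows "capacity_region n m (1, F12, F21, 0) =
     {(R1, R2). 0 \<le> R1 \<and> 0 \<le> R2 \<and>
        R1 \<le> real n \<and> R2 \<le> max (real n) (real m) \<and>
        R1 + R2 \<le> pos_part (real n - real m) + max (real n) (real m)}"
proof (rule pair_set_eqI, rule iffI)
  fix R1 R2 :: real
  assume "0 \<le> R1 \<and>
    0 \<le> R2 \<and>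
    R1 \<le> real n \<and>
    R2 \<le> max (real n) (real m) \<and>
    R1 + R2 \<le> pos_part (real n - real m) + max (real n) (real m)"
  then have R: "0 \<le> R1" "0 \<le> R2" "R1 \<le> real n" "R2 \<le> max (real n) (real m)"
    "R1 + R2 \<le> pos_part (real n - real m) + max (real n) (real m)"
    by simp_all
  show "(R1, R2) \<in> capacity_region n m (1, F12, F21, 0)"
  proof (cases "m \<le> n")
    case True
    \<comment> \<open>Either link serves: with \<open>F12\<close> transmitter 2 relays, with
      \<open>F21\<close> transmitter 1 cancels in advance.\<close>
    have "corner n m (1, F12, F21, 0) n (n - m)"
      using assms
    proof
      assume "F12 = 1"
      then show ?thesis by (intro corner_swap[OF corner_relay[OF True]]) simp
    next
      assume "F21 = 1"
      then show ?thesis using corner_precancel[OF True] by simp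
    qed
    then show ?thesis
      by (rule capacity_region_weak[OF True _ corner_relay[OF True]]) (use R True in \<open>auto simp: pos_part_def\<close>)
  next
    case False
    then show ?thesis
      using R by (intro capacity_region_strong_fb) (auto simp: pos_part_def)
  qed
next
  fix R1 R2
  assume R: "(R1, R2) \<in> capacity_region n m (1, F12, F21, 0)"
  have "R1 \<le> real n" by (rule capacity_region_rate1[OF R reliable_direct_link]) auto
  then show "0 \<le> R1 \<and> 0 \<le> R2 \<and> R1 \<le> real n \<and> R2 \<le> max (real n) (real m) \<and>
        R1 + R2 \<le> pos_part (real n - real m) + max (real n) (real m)"
    using capacity_region_nonneg[OF R] capacity_region_cutset[OF R] capacity_region_sum[OF R] by simp
qed

text \<open>For \<open>m \<le> n\<close> the one link \<open>F21\<close> yields both corners, by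
  relaying and by cancelling in advance. For larger \<open>m\<close> schemes without feedback
  suffice: a square for \<open>2 * n \<le> m\<close>, and otherwise the segment between
  \<open>(n, m - n)\<close> and its mirror image.\<close>

lemma capacity_region_cross:
  "capacity_region n m (0, F12, 1, 0) =
     {(R1, R2). 0 \<le> R1 \<and> 0 \<le> R2 \<and> R1 \<le> real n \<and> R2 \<le> real n \<and>
        R1 + R2 \<le> pos_part (real n - real m) + max (real n) (real m)}"
proof (rule pair_set_eqI, rule iffI)
  fix R1 R2 :: real
  assume "0 \<le> R1 \<and>
    0 \<le> R2 \<and>
    R1 \<le> real n \<and>
    R2 \<le> real n \<and>
    R1 + R2 \<le> pos_part (real n - real m) + max (real n) (real m)"
  then have R: "0 \<le> R1" "0 \<le> R2" "R1 \<le> real n" "R2 \<le> real n"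
    "R1 + R2 \<le> pos_part (real n - real m) + max (real n) (real m)"
    by simp_all
  consider "m \<le> n" | "2 * n \<le> m" | "n < m" "m \<le> 2 * n" by linarith
  then show "(R1, R2) \<in> capacity_region n m (0, F12, 1, 0)"
  proof cases
    case 1
    then show ?thesis
      by (intro capacity_region_weak[OF 1 corner_precancel[OF 1] corner_relay[OF 1]])
        (use R in \<open>auto simp: pos_part_def\<close>)
  next
    case 2
    show ?thesis
      by (rule capacity_region_segment[OF corner_disjoint[OF 2] corner_disjoint[OF 2] R(1,2)])
        (use R in auto)
  next
    case 3
    show ?thesis
    proof (rule capacity_region_segment[OF corner_periodic[OF 3] corner_swap[OF corner_periodic[OF 3]] R(1,2)])
      have "(2 * real n - real m) * (R1 + R2) \<le> (2 * real n - real m) * real m"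
        using R(5) 3 by (intro mult_left_mono) (auto simp: pos_part_def)
      then show "(real n - real (m - n)) * R1 + (real n - real (m - n)) * R2
          \<le> (real n - real (m - n)) * real n + (real n - real (m - n)) * real (m - n)"
        using 3 by (simp add: algebra_simps)
    qed (use R 3 in auto)
  qed
next
  fix R1 R2
  assume R: "(R1, R2) \<in> capacity_region n m (0, F12, 1, 0)"
  have "R1 \<le> real n" by (rule capacity_region_rate1[OF R reliable_direct_link]) auto
  moreover have "R2 \<le> real n" by (rule capacity_region_rate2[OF R reliable_direct_link]) auto
  ultimately show "0 \<le> R1 \<and> 0 \<le> R2 \<and> R1 \<le> real n \<and> R2 \<le> real n \<and>
        R1 + R2 \<le> pos_part (real n - real m) + max (real n) (real m)"
    using capacity_region_nonneg[OF R] capacity_region_sum[OF R] by simp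
qed

text \<open>For \<open>2 * m \<le> n\<close> one segment of slope -2 joins \<open>avoid\<close> to
  \<open>relay\<close>. Otherwise the lines of the sum bound and of the bound on 2 R1 + R2 meet at
  \<open>(m, 2 * (n - m))\<close>, the corner of \<open>resolve\<close>; hence the case split at
  \<open>R1 = m\<close>. In each case the line of the segment is one of these bounds, multiplied by
  \<open>m\<close>, \<open>2 * m - n\<close> or \<open>n - m\<close>.\<close>

lemma capacity_region_single_weak:
  assumes "m \<le> n" "0 \<le> R1" "0 \<le> R2" "R1 \<le> real n" "R2 \<le> real n" "R1 + R2 \<le> 2 * real n - real m"
    and two: "2 * R1 + R2 \<le> 2 * real n - real m + max (real n - real m) (real m)"
  shows "(R1, R2) \<in> capacity_region n m (1, 0, 0, 0)"
proof -
  have relay: "corner n m (1, 0, 0, 0) (n - m) n" using assms(1) by (intro corner_relay) simp_all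
  have avoid: "corner n m (1, 0, 0, 0) n (n - 2 * m)" using assms(1) by (rule corner_avoid)
  consider "2 * m \<le> n" | "n < 2 * m" "R1 \<le> real m" | "n < 2 * m" "real m < R1" by linarith
  then show ?thesis
  proof cases
    case 1
    show ?thesis
    proof (rule capacity_region_segment[OF avoid relay assms(2,3)])
      have "2 * R1 + R2 \<le> 3 * real n - 2 * real m" using two 1 by simp
      then have "real m * (2 * R1 + R2) \<le> real m * (3 * real n - 2 * real m)"
        by (intro mult_left_mono) auto
      then show "(real n - real (n - 2 * m)) * R1 + (real n - real (n - m)) * R2
          \<le> (real n - real (n - 2 * m)) * real n + (real n - real (n - m)) * real (n - 2 * m)"
        using assms(1) 1 by (simp add: algebra_simps)
    qed (use assms in auto)
  next
    case 2
    have resolve: "corner n m (1, 0, 0, 0) m (2 * (n - m))"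
      using assms(1) 2 by (intro corner_resolve) simp_all
    show ?thesis
    proof (rule capacity_region_segment[OF resolve relay assms(2,3)])
      have "(2 * real m - real n) * (R1 + R2) \<le> (2 * real m - real n) * (2 * real n - real m)"
        using assms(6) 2 by (intro mult_left_mono) auto
      then show "(real n - real (2 * (n - m))) * R1 + (real m - real (n - m)) * R2
          \<le> (real n - real (2 * (n - m))) * real m + (real m - real (n - m)) * real (2 * (n - m))"
        using assms(1) by (simp add: algebra_simps)
    qed (use assms 2 in auto)
  next
    case 3
    have resolve: "corner n m (1, 0, 0, 0) m (2 * (n - m))"
      using assms(1) 3 by (intro corner_resolve) simp_all
    have sum: "2 * R1 + R2 \<le> 2 * real n" using two 3 assms(1) by (simp add: max_def split: if_splits)
    show ?thesis
    proof (rule capacity_region_segment[OF avoid resolve assms(2,3)])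
      have "(real n - real m) * (2 * R1 + R2) \<le> (real n - real m) * (2 * real n)"
        using sum assms(1) by (intro mult_left_mono) auto
      moreover have "n - 2 * m = 0" using 3 by simp
      ultimately show "(real (2 * (n - m)) - real (n - 2 * m)) * R1 + (real n - real m) * R2
          \<le> (real (2 * (n - m)) - real (n - 2 * m)) * real n + (real n - real m) * real (n - 2 * m)"
        using assms(1) by (simp add: algebra_simps)
      show "R2 \<le> real (2 * (n - m))" using sum 3 assms(1) by (simp add: of_nat_diff)
    qed (use assms 3 in auto)
  qed
qed

lemma capacity_region_single:
  "capacity_region n m (1, 0, 0, 0) =
     {(R1, R2). 0 \<le> R1 \<and> 0 \<le> R2 \<and>
        R1 \<le> real n \<and> R2 \<le> max (real n) (real m) \<and>
        R1 + R2 \<le> pos_part (real n - real m) + max (real n) (real m) \<and>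
        2 * R1 + R2 \<le> pos_part (real n - real m) + max (real n) (real m) + max (real n - real m) (real m)}"
proof (rule pair_set_eqI, rule iffI)
  fix R1 R2 :: real
  assume "0 \<le> R1 \<and>
    0 \<le> R2 \<and>
    R1 \<le> real n \<and>
    R2 \<le> max (real n) (real m) \<and>
    R1 + R2 \<le> pos_part (real n - real m) + max (real n) (real m) \<and>
    2 * R1 + R2 \<le> pos_part (real n - real m) + max (real n) (real m) + max (real n - real m) (real m)"
  then have R: "0 \<le> R1" "0 \<le> R2" "R1 \<le> real n" "R2 \<le> max (real n) (real m)"
    "R1 + R2 \<le> pos_part (real n - real m) + max (real n) (real m)"
    "2 * R1 + R2 \<le> pos_part (real n - real m) + max (real n) (real m) + max (real n - real m) (real m)"
    by simp_all
  show "(R1, R2) \<in> capacity_region n m (1, 0, 0, 0)"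
  proof (cases "m \<le> n")
    case True
    then have "pos_part (real n - real m) = real n - real m" "max (real n) (real m) = real n"
      by (simp_all add: pos_part_def)
    with True R show ?thesis by (intro capacity_region_single_weak) simp_all
  next
    case False
    then show ?thesis
      using R(1-5) by (intro capacity_region_strong_fb) (auto simp: pos_part_def)
  qed
next
  fix R1 R2
  assume R: "(R1, R2) \<in> capacity_region n m (1, 0, 0, 0)"
  have "R1 \<le> real n" by (rule capacity_region_rate1[OF R reliable_direct_link]) auto
  then show "0 \<le> R1 \<and> 0 \<le> R2 \<and> R1 \<le> real n \<and> R2 \<le> max (real n) (real m) \<and>
        R1 + R2 \<le> pos_part (real n - real m) + max (real n) (real m) \<and>
        2 * R1 + R2 \<le> pos_part (real n - real m) + max (real n) (real m) + max (real n - real m) (real m)"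
    using capacity_region_nonneg[OF R] capacity_region_cutset[OF R] capacity_region_sum[OF R]
      capacity_region_two_one[OF R] by simp
qed

theorem mainTheorem1:
  fixes n m :: nat
  shows
    "(\<forall>F \<in> {(1,0,0,1), (1,1,0,1), (1,1,1,1)}.
        capacity_region n m F =
          {(R1, R2). 0 \<le> R1 \<and> 0 \<le> R2 \<and>
             R1 \<le> max (real n) (real m) \<and> R2 \<le> max (real n) (real m) \<and>
             R1 + R2 \<le> pos_part (real n - real m) + max (real n) (real m)}) \<and>
     (\<forall>F \<in> {(1,1,0,0), (1,1,1,0), (1,0,1,0)}.
        capacity_region n m F =
          {(R1, R2). 0 \<le> R1 \<and> 0 \<le> R2 \<and>
             R1 \<le> real n \<and> R2 \<le> max (real n) (real m) \<and>
             R1 + R2 \<le> pos_part (real n - real m) + max (real n) (real m)}) \<and>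
     (\<forall>F \<in> {(0,1,1,0), (0,0,1,0)}.
        capacity_region n m F =
          {(R1, R2). 0 \<le> R1 \<and> 0 \<le> R2 \<and>
             R1 \<le> real n \<and> R2 \<le> real n \<and>
             R1 + R2 \<le> pos_part (real n - real m) + max (real n) (real m)}) \<and>
     capacity_region n m (1,0,0,0) =
       {(R1, R2). 0 \<le> R1 \<and> 0 \<le> R2 \<and>
          R1 \<le> real n \<and> R2 \<le> max (real n) (real m) \<and>
          R1 + R2 \<le> pos_part (real n - real m) + max (real n) (real m) \<and>
          2 * R1 + R2 \<le> pos_part (real n - real m) + max (real n) (real m)
                          + max (real n - real m) (real m)}"
  using capacity_region_both capacity_region_own capacity_region_cross capacity_region_single by auto

end
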